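(* Every connected component of a dual equivalence graph of type $(n,n)$ is isomorphic to the standard dual equivalence graph $\mathcal{G}_\lambda$ for a unique partition $\lambda$ of $n$.
   Context: Tableaux conventions. Partitions $\lambda=(\lambda_1\ge\dots\ge\lambda_l>0)$; French diagram: cells $(i,j)$ with $1\le i\le\lambda_j$, row $1$ at the bottom. $\mathrm{SYT}(\lambda)$: bijections from the cells to $[n]$ increasing along rows (left to right) and columns (bottom to top). Content of $(i,j)$ is $i-j$. Content reading word: entries in increasing order of content, each diagonal read southwest to northeast. Descent signature $\sigma(T)\in\{\pm1\}^{n-1}$: $\sigma(T)_i=+1$ iff $i$ appears left of $i+1$ in the reading word. For $1<i<n$, $d_i$ on words: identity if $i$ lies positionally between $i-1$ and $i+1$; otherwise swap $i$ with whichever of $i\pm1$ is farther from $i$. On tableaux, $d_i$ swaps the corresponding entries (result is standard). A signed, colored graph of type $(n,N)$ is $(V,\sigma,E)$: finite $V$, $\sigma:V\to\{\pm1\}^{N-1}$, and for $1<i<n$ a set $E_i$ of $2$-element subsets of $V$. It is a dual equivalence graph of type $(n,N)$ if $n\le N$ and (indices only where defined): (ax1) for $w\in V$, $1<i<n$: $\sigma(w)_{i-1}=-\sigma(w)_i$ iff some $x$ has $\{w,x\}\in E_i$, and such $x$ is unique; (ax2) if $\{w,x\}\in E_i$: $\sigma(w)_j=-\sigma(x)_j$ for $j=i-1,i$, and $\sigma(w)_h=\sigma(x)_h$ for $h<i-2$ and $h>i+1$; (ax3) if $\{w,x\}\in E_i$ and $\sigma(w)_{i-2}=-\sigma(x)_{i-2}$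 then $\sigma(w)_{i-2}=-\sigma(w)_{i-1}$; if $\sigma(w)_{i+1}=-\sigma(x)_{i+1}$ then $\sigma(w)_{i+1}=-\sigma(w)_i$; (ax4) each connected component of $(V,E_{i-1}\cup E_i)$ is: a single vertex; or a path $x,y,z$ with $\{x,y\}\in E_{i-1}$, $\{y,z\}\in E_i$ and no other edges; or two vertices joined by both an $E_{i-1}$- and an $E_i$-edge. Each connected component of $(V,E_{i-2}\cup E_{i-1}\cup E_i)$ is: (a) a single vertex; (b) a path $p,q,r,s$ with only edges $\{p,q\}\in E_{i-2}$, $\{q,r\}\in E_{i-1}$, $\{r,s\}\in E_i$; (c) five vertices $a,b,c,d,e$ with only edges $\{a,b\}\in E_{i-2}\cap E_{i-1}$, $\{b,c\}\in E_i$, $\{c,d\}\in E_{i-2}$, $\{d,e\}\in E_{i-1}\cap E_i$; (d) six vertices $u,v,w,x,y,z$ with only edges $\{u,v\}\in E_{i-1}$, $\{v,w\}\in E_{i-2}$, $\{v,x\}\in E_i$, $\{w,y\}\in E_i$, $\{x,y\}\in E_{i-2}$, $\{y,z\}\in E_{i-1}$; (ax5) if $\{w,x\}\in E_i$, $\{x,y\}\in E_j$, $|i-j|\ge3$, then some $v$ has $\{w,v\}\in E_j$, $\{v,y\}\in E_i$; (ax6) for each $1<i<n$, any two vertices of a connected component of $(V,E_2\cup\dots\cup E_i)$ are joined by a path in it using at most one $E_i$-edge. $\mathcal{G}_\lambda$ ($|\lambda|=n$) is the graph of type $(n,n)$ on $\mathrm{SYT}(\lambda)$ with the descent signature and $E_i=\{\{T,d_i(T)\}:d_i(T)\ne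 T\}$. An isomorphism of signed colored graphs of type $(n,N)$ is a bijection $\phi$ on vertices with $\sigma(\phi(v))=\sigma(v)$ and mapping $i$-edges to $i$-edges for every $i$. *)

theory Defs
  imports Main "HOL-Library.Product_Lexorder"
begin

definition is_partition :: "nat list \<Rightarrow> bool" where
  "is_partition lam \<longleftrightarrow> sorted_wrt (\<ge>) lam \<and> 0 \<notin> set lam"

text \<open>Cell (i,j): column i, row j, with 1 \<le> i \<le> lam_j; row 1 at the bottom.\<close>
definition cells :: "nat list \<Rightarrow> (nat \<times> nat) set" where
  "cells lam = {(i, j). 1 \<le> j \<and> j \<le> length lam \<and> 1 \<le> i \<and> i \<le> lam ! (j - 1)}"

text \<open>Standard Young tableaux, represented canonically as functions that are 0 off the diagram.\<close>
definition SYT :: "nat list \<Rightarrow> (nat \<times> nat \<Rightarrow> nat) set" where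
  "SYT lam = {T. bij_betw T (cells lam) {1..sum_list lam}
     \<and> (\<forall>c. c \<notin> cells lam \<longrightarrow> T c = 0)
     \<and> (\<forall>i j. (i, j) \<in> cells lam \<and> (Suc i, j) \<in> cells lam \<longrightarrow> T (i, j) < T (Suc i, j))
     \<and> (\<forall>i j. (i, j) \<in> cells lam \<and> (i, Suc j) \<in> cells lam \<longrightarrow> T (i, j) < T (i, Suc j))}"

definition content :: "nat \<times> nat \<Rightarrow> int" where
  "content c = int (fst c) - int (snd c)"

text \<open>Cells in content reading order: increasing content, each diagonal southwest to northeast.\<close>
definition reading_cells :: "nat list \<Rightarrow> (nat \<times> nat) list" where
  "reading_cells lam = sort_key (\<lambda>c. (content c, fst c)) (sorted_list_of_set (cells lam))"

definition reading_word :: "nat list \<Rightarrow> (nat \<times> nat \<Rightarrow> nat) \<Rightarrow> nat list" where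
  "reading_word lam T = map T (reading_cells lam)"

definition pos :: "nat list \<Rightarrow> nat \<Rightarrow> nat" where
  "pos w k = (LEAST p. p < length w \<and> w ! p = k)"

text \<open>Descent signature: entry k is +1 (True) iff k appears left of k+1 in the reading word.\<close>
definition desc_sig :: "nat list \<Rightarrow> (nat \<times> nat \<Rightarrow> nat) \<Rightarrow> nat \<Rightarrow> bool" where
  "desc_sig lam T k = (pos (reading_word lam T) k < pos (reading_word lam T) (Suc k))"

definition swap_vals :: "nat \<Rightarrow> nat \<Rightarrow> nat \<Rightarrow> nat" where
  "swap_vals a b x = (if x = a then b else if x = b then a else x)"

definition d_perm :: "nat \<Rightarrow> nat list \<Rightarrow> nat \<Rightarrow> nat" where
  "d_perm i w = (let p = pos w in
     if (p (i - 1) < p i \<and> p i < p (Suc i)) \<or> (p (Suc i) < p i \<and> p i < p (i - 1)) then id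
     else if \<bar>int (p i) - int (p (i - 1))\<bar> > \<bar>int (p i) - int (p (Suc i))\<bar>
       then swap_vals i (i - 1) else swap_vals i (Suc i))"

definition word_d :: "nat \<Rightarrow> nat list \<Rightarrow> nat list" where
  "word_d i w = map (d_perm i w) w"

definition tab_d :: "nat list \<Rightarrow> nat \<Rightarrow> (nat \<times> nat \<Rightarrow> nat) \<Rightarrow> (nat \<times> nat \<Rightarrow> nat)" where
  "tab_d lam i T = d_perm i (reading_word lam T) \<circ> T"

definition G_edges :: "nat list \<Rightarrow> nat \<Rightarrow> (nat \<times> nat \<Rightarrow> nat) set set" where
  "G_edges lam i = (if 1 < i \<and> i < sum_list lam
     then {{T, tab_d lam i T} | T. T \<in> SYT lam \<and> tab_d lam i T \<noteq> T} else {})"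

text \<open>A signed colored graph of type (n,N) is (V, sigma, E): sigma v k is the sign
  (True = +1) for 1 \<le> k \<le> N-1; E i is the set of i-edges for 1 < i < n.
  Values outside these index ranges are irrelevant.\<close>
definition scg :: "nat \<Rightarrow> nat \<Rightarrow> 'a set \<Rightarrow> ('a \<Rightarrow> nat \<Rightarrow> bool) \<Rightarrow> (nat \<Rightarrow> 'a set set) \<Rightarrow> bool" where
  "scg n N V s E \<longleftrightarrow> finite V \<and>
     (\<forall>i. 1 < i \<and> i < n \<longrightarrow> E i \<subseteq> {{x, y} | x y. x \<in> V \<and> y \<in> V \<and> x \<noteq> y})"

definition conn :: "nat set \<Rightarrow> (nat \<Rightarrow> 'a set set) \<Rightarrow> 'a \<Rightarrow> 'a \<Rightarrow> bool" where
  "conn K E = (\<lambda>x y. \<exists>i\<in>K. {x, y} \<in> E i)\<^sup>*\<^sup>*"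

definition component :: "nat set \<Rightarrow> 'a set \<Rightarrow> (nat \<Rightarrow> 'a set set) \<Rightarrow> 'a \<Rightarrow> 'a set" where
  "component K V E v = {w \<in> V. conn K E v w}"

definition cedges :: "nat set \<Rightarrow> (nat \<Rightarrow> 'a set set) \<Rightarrow> 'a set \<Rightarrow> (nat \<times> 'a set) set" where
  "cedges K E C = {(k, e). k \<in> K \<and> e \<in> E k \<and> e \<subseteq> C}"

definition ax4_two :: "nat \<Rightarrow> (nat \<Rightarrow> 'a set set) \<Rightarrow> 'a set \<Rightarrow> bool" where
  "ax4_two i E C \<longleftrightarrow> (let CE = cedges {i - 1, i} E C in
     (\<exists>x. C = {x} \<and> CE = {})
   \<or> (\<exists>x y z. C = {x, y, z} \<and> card C = 3 \<and> CE = {(i - 1, {x, y}), (i, {y, z})})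
   \<or> (\<exists>x y. C = {x, y} \<and> card C = 2 \<and> CE = {(i - 1, {x, y}), (i, {x, y})}))"

definition ax4_three :: "nat \<Rightarrow> (nat \<Rightarrow> 'a set set) \<Rightarrow> 'a set \<Rightarrow> bool" where
  "ax4_three i E C \<longleftrightarrow> (let CE = cedges {i - 2, i - 1, i} E C in
     (\<exists>x. C = {x} \<and> CE = {})
   \<or> (\<exists>p q r s. C = {p, q, r, s} \<and> card C = 4 \<and>
        CE = {(i - 2, {p, q}), (i - 1, {q, r}), (i, {r, s})})
   \<or> (\<exists>a b c d e. C = {a, b, c, d, e} \<and> card C = 5 \<and>
        CE = {(i - 2, {a, b}), (i - 1, {a, b}), (i, {b, c}), (i - 2, {c, d}),
              (i - 1, {d, e}), (i, {d, e})})
   \<or> (\<exists>u v w x y z. C = {u, v, w, x, y, z} \<and> card C = 6 \<and>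
        CE = {(i - 1, {u, v}), (i - 2, {v, w}), (i, {v, x}), (i, {w, y}),
              (i - 2, {x, y}), (i - 1, {y, z})}))"

definition deg :: "nat \<Rightarrow> nat \<Rightarrow> 'a set \<Rightarrow> ('a \<Rightarrow> nat \<Rightarrow> bool) \<Rightarrow> (nat \<Rightarrow> 'a set set) \<Rightarrow> bool" where
  "deg n N V s E \<longleftrightarrow> scg n N V s E \<and> n \<le> N \<and>
   \<comment> \<open>ax1\<close>
   (\<forall>w\<in>V. \<forall>i. 1 < i \<and> i < n \<longrightarrow>
      ((s w (i - 1) \<noteq> s w i) \<longleftrightarrow> (\<exists>x. {w, x} \<in> E i)) \<and>
      (\<forall>x y. {w, x} \<in> E i \<and> {w, y} \<in> E i \<longrightarrow> x = y)) \<and>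
   \<comment> \<open>ax2\<close>
   (\<forall>i w x. 1 < i \<and> i < n \<and> {w, x} \<in> E i \<longrightarrow>
      s w (i - 1) \<noteq> s x (i - 1) \<and> s w i \<noteq> s x i \<and>
      (\<forall>h. 1 \<le> h \<and> h < N \<and> (h + 2 < i \<or> i + 1 < h) \<longrightarrow> s w h = s x h)) \<and>
   \<comment> \<open>ax3\<close>
   (\<forall>i w x. 1 < i \<and> i < n \<and> {w, x} \<in> E i \<longrightarrow>
      (3 \<le> i \<and> s w (i - 2) \<noteq> s x (i - 2) \<longrightarrow> s w (i - 2) \<noteq> s w (i - 1)) \<and>
      (i + 1 < N \<and> s w (i + 1) \<noteq> s x (i + 1) \<longrightarrow> s w (i + 1) \<noteq> s w i)) \<and>
   \<comment> \<open>ax4\<close>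
   (\<forall>i v. 2 < i \<and> i < n \<and> v \<in> V \<longrightarrow> ax4_two i E (component {i - 1, i} V E v)) \<and>
   (\<forall>i v. 3 < i \<and> i < n \<and> v \<in> V \<longrightarrow> ax4_three i E (component {i - 2, i - 1, i} V E v)) \<and>
   \<comment> \<open>ax5\<close>
   (\<forall>i j w x y. 1 < i \<and> i < n \<and> 1 < j \<and> j < n \<and> (i + 3 \<le> j \<or> j + 3 \<le> i) \<and>
        {w, x} \<in> E i \<and> {x, y} \<in> E j \<longrightarrow> (\<exists>v. {w, v} \<in> E j \<and> {v, y} \<in> E i)) \<and>
   \<comment> \<open>ax6\<close>
   (\<forall>i x y. 1 < i \<and> i < n \<and> x \<in> V \<and> y \<in> V \<and> conn {2..i} E x y \<longrightarrow>
      conn {2..<i} E x y \<or>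
      (\<exists>a b. {a, b} \<in> E i \<and> conn {2..<i} E x a \<and> conn {2..<i} E b y))"

definition scg_iso :: "nat \<Rightarrow> nat \<Rightarrow> 'a set \<Rightarrow> ('a \<Rightarrow> nat \<Rightarrow> bool) \<Rightarrow> (nat \<Rightarrow> 'a set set)
    \<Rightarrow> 'b set \<Rightarrow> ('b \<Rightarrow> nat \<Rightarrow> bool) \<Rightarrow> (nat \<Rightarrow> 'b set set) \<Rightarrow> ('a \<Rightarrow> 'b) \<Rightarrow> bool" where
  "scg_iso n N V1 s1 E1 V2 s2 E2 \<phi> \<longleftrightarrow> bij_betw \<phi> V1 V2 \<and>
     (\<forall>v\<in>V1. \<forall>k. 1 \<le> k \<and> k < N \<longrightarrow> s2 (\<phi> v) k = s1 v k) \<and>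
     (\<forall>i. 1 < i \<and> i < n \<longrightarrow> (\<forall>x\<in>V1. \<forall>y\<in>V1. {x, y} \<in> E1 i \<longleftrightarrow> {\<phi> x, \<phi> y} \<in> E2 i))"

definition restrict_edges :: "(nat \<Rightarrow> 'a set set) \<Rightarrow> 'a set \<Rightarrow> nat \<Rightarrow> 'a set set" where
  "restrict_edges E C i = {e \<in> E i. e \<subseteq> C}"

end

theory Submission
  imports Defs
begin

text \<open>By induction on \<open>n\<close>, every vertex of a dual equivalence graph is labelled by a standard tableau
  compatibly with signs and edges.  In the step from \<open>n\<close> to \<open>n + 1\<close>, each component without
  \<open>n\<close>-edges is a \<open>G\<^sub>\<lambda>\<close>, and its last sign determines a unique outer corner of \<open>\<lambda>\<close> for the
  entry \<open>n + 1\<close>.  An \<open>n\<close>-edge commutes with the edges of colour at most \<open>n - 3\<close>, so by rigidity it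
  preserves the positions of \<open>1, \<dots>, n - 2\<close>, and these may be rearranged at will.  Placing
  \<open>n - 2\<close> (and \<open>n - 3\<close>) suitably, the local axioms force the \<open>n\<close>-edge to act as the elementary dual
  equivalence.  The last axiom makes the labelling injective on components.\<close>

section \<open>Content words\<close>

text \<open>The labels of components without \<open>n\<close>-edges are chosen independently, so a
  priori nothing relates the words at the two ends of an \<open>n\<close>-edge, and their shapes
  before the last letter need not agree. What is available is rigidity on prefixes, and the
  alternation of addable and removable corners along the boundary. A removable corner strictly
  between two addable ones acts as a probe: placed just before the letter in question it yields
  different signs for the two candidates, and as a median it lets a dual equivalence exchange the
  two letters that it separates. The two kinds of \<open>n\<close>-edges differ in difficulty. One
  that leaves \<open>n + 1\<close> in place becomes, after a rearrangement, an edge of colour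
  \<open>n - 1\<close>, so it stays inside a component without \<open>n\<close>-edges. One that
  moves \<open>n + 1\<close> leaves this component, and the two cells on which it acts must be
  recognised at its other end. Knowing which removable corners lie between them suffices, and this
  knowledge is carried across by the three-colour part of the fourth axiom.\<close>

text \<open>A shape is encoded by its boundary path: \<open>e k\<close> holds iff the step between the diagonals
  \<open>k - 1\<close> and \<open>k\<close> is vertical, that is, iff \<open>k = \<lambda>\<^sub>j - j + 1\<close> for some row \<open>j \<ge> 1\<close>.
  Adding a cell of content \<open>k\<close> exchanges the values at \<open>k\<close> and \<open>k + 1\<close>.  A standard
  tableau becomes the word of the contents of its entries \<open>1, 2, \<dots>\<close>; as the contents of three
  consecutive entries are distinct, they determine descents and elementary dual equivalences.\<close>

definition addable :: "(int \<Rightarrow> bool) \<Rightarrow> int \<Rightarrow> bool" where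
  "addable e k \<longleftrightarrow> e k \<and> \<not> e (k + 1)"

definition removable :: "(int \<Rightarrow> bool) \<Rightarrow> int \<Rightarrow> bool" where
  "removable e k \<longleftrightarrow> \<not> e k \<and> e (k + 1)"

definition between :: "int \<Rightarrow> int \<Rightarrow> int \<Rightarrow> bool" where
  "between x y z \<longleftrightarrow> (x < y \<and> y < z) \<or> (z < y \<and> y < x)"

definition add_cell :: "(int \<Rightarrow> bool) \<Rightarrow> int \<Rightarrow> (int \<Rightarrow> bool)" where
  "add_cell e k = e(k := False, k + 1 := True)"

text \<open>If all rows have length zero, the numbers \<open>\<lambda>\<^sub>j - j + 1\<close> are
  exactly the integers up to 0.\<close>

definition empty_shape :: "int \<Rightarrow> bool" where
  "empty_shape k \<longleftrightarrow> k \<le> 0"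

definition shape :: "int list \<Rightarrow> (int \<Rightarrow> bool)" where
  "shape w = foldl add_cell empty_shape w"

primrec growth :: "(int \<Rightarrow> bool) \<Rightarrow> int list \<Rightarrow> bool" where
  "growth e [] \<longleftrightarrow> True"
| "growth e (k # w) \<longleftrightarrow> addable e k \<and> growth (add_cell e k) w"

definition std_word :: "int list \<Rightarrow> bool" where
  "std_word w \<longleftrightarrow> growth empty_shape w"

lemma shape_Nil [simp]: "shape [] = empty_shape"
  by (simp add: shape_def)

lemma shape_append: "shape (u @ w) = foldl add_cell (shape u) w"
  by (simp add: shape_def)

lemma growth_append: "growth e (u @ w) \<longleftrightarrow> growth e u \<and> growth (foldl add_cell e u) w"
  by (induction u arbitrary: e) auto

lemma std_word_Nil [simp]: "std_word []"
  by (simp add: std_word_def)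

lemma std_word_append: "std_word (u @ w) \<longleftrightarrow> std_word u \<and> growth (shape u) w"
  by (simp add: std_word_def growth_append shape_def)

lemma shape_snoc: "shape (u @ [k]) = add_cell (shape u) k"
  by (simp add: shape_append)

lemma std_word_snoc: "std_word (u @ [k]) \<longleftrightarrow> std_word u \<and> addable (shape u) k"
  by (simp add: std_word_append)

section \<open>Addable and removable corners along the boundary\<close>

lemma ex_removable_between:
  fixes a b :: int
  assumes "\<not> e a" "e b" "a \<le> b"
  shows "\<exists>f. a \<le> f \<and> f < b \<and> removable e f"
  using assms(3) assms
proof (induction b rule: int_ge_induct)
  case base
  then show ?case by simp
next
  case (step b)
  show ?case
  proof (cases "e b")
    case True
    then show ?thesis using step by force
  next
    case False
    then show ?thesis using step by (auto simp: removable_def)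
  qed
qed

lemma ex_addable_between:
  fixes a b :: int
  assumes "e a" "\<not> e b" "a \<le> b"
  shows "\<exists>f. a \<le> f \<and> f < b \<and> addable e f \<and> (\<forall>g. a \<le> g \<and> g \<le> f \<longrightarrow> e g)"
  using assms(3) assms
proof (induction b rule: int_ge_induct)
  case base
  then show ?case by simp
next
  case (step b)
  show ?case
  proof (cases "\<forall>g. a \<le> g \<and> g \<le> b \<longrightarrow> e g")
    case True
    then show ?thesis using step by (intro exI[of _ b]) (auto simp: addable_def)
  next
    case False
    define S where "S = {g. a \<le> g \<and> g \<le> b \<and> \<not> e g}"
    have fin: "finite S" by (rule finite_subset[of _ "{a..b}"]) (auto simp: S_def)
    have ne: "S \<noteq> {}" using False by (auto simp: S_def)
    define g where "g = Min S"
    have g: "g \<in> S" using Min_in[OF fin ne] g_def by simp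
    have lt: "e h" if "a \<le> h" "h < g" for h
    proof (rule ccontr)
      assume "\<not> e h"
      then have "h \<in> S" using that g by (auto simp: S_def)
      then show False using Min_le[OF fin] that g_def by fastforce
    qed
    have ag: "a < g" using g step(3) by (cases "a = g") (auto simp: S_def)
    show ?thesis
      using ag g lt by (intro exI[of _ "g - 1"]) (auto simp: addable_def S_def)
  qed
qed

text \<open>For \<open>k < k'\<close> the path is \<open>False\<close> at \<open>k + 1\<close> and
  \<open>True\<close> at \<open>k'\<close>, and where it returns to \<open>True\<close> there is a
  removable corner. This corner is the probe of most later arguments.\<close>

lemma addable_separated:
  assumes "addable e k" "addable e k'" "k \<noteq> k'"
  obtains f where "removable e f" "between k f k'"
proof -
  have *: "\<exists>f. removable e f \<and> between k f k'" if "addable e k" "addable e k'" "k < k'" for k k'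
  proof -
    have "\<exists>f. k + 1 \<le> f \<and> f < k' \<and> removable e f"
      using that by (intro ex_removable_between) (auto simp: addable_def)
    then show ?thesis by (auto simp: between_def)
  qed
  then show ?thesis using that assms *[of k k'] *[of k' k] by (auto simp: between_def neq_iff)
qed

text \<open>Removable corners \<open>k\<close> and \<open>k + 1\<close> would need opposite values
  at \<open>k + 1\<close>. A gap of two is exactly what lets two cells be added in either
  order.\<close>

lemma removable_far:
  assumes "removable e k" "removable e k'" "k \<noteq> k'"
  shows "k + 2 \<le> k' \<or> k' + 2 \<le> k"
proof -
  have "k' \<noteq> k + 1" "k \<noteq> k' + 1" using assms by (auto simp: removable_def)
  then show ?thesis using assms(3) by linarith
qed

lemma removable_add_cell: "addable e k \<Longrightarrow> removable (add_cell e k) k"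
  by (auto simp: removable_def add_cell_def)

lemma add_cell_inj:
  assumes "add_cell e k = add_cell e' k" "addable e k" "addable e' k"
  shows "e = e'"
proof
  fix l
  have "add_cell e k l = add_cell e' k l" by (simp add: assms(1))
  then show "e l = e' l" using assms(2,3)
    by (auto simp: add_cell_def addable_def split: if_splits)
qed

lemma add_cell_commute:
  assumes "k + 2 \<le> l \<or> l + 2 \<le> k"
  shows "add_cell (add_cell e k) l = add_cell (add_cell e l) k"
  using assms by (auto simp: add_cell_def fun_eq_iff)

lemma addable_add_cell_far:
  assumes "k + 2 \<le> l \<or> l + 2 \<le> k"
  shows "addable (add_cell e k) l \<longleftrightarrow> addable e l"
  using assms by (auto simp: add_cell_def addable_def)

lemma removable_add_cell_far:
  assumes "k + 2 \<le> l \<or> l + 2 \<le> k"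
  shows "removable (add_cell e k) l \<longleftrightarrow> removable e l"
  using assms by (auto simp: add_cell_def removable_def)

lemma growth_swap:
  assumes "k + 2 \<le> l \<or> l + 2 \<le> k"
  shows "growth e (k # l # w) \<longleftrightarrow> growth e (l # k # w)"
  using assms by (auto simp: addable_add_cell_far add_cell_commute[OF assms] disj_commute)

lemma shape_bounds:
  "(k \<le> - int (length w) \<longrightarrow> shape w k) \<and> (int (length w) < k \<longrightarrow> \<not> shape w k)" if "std_word w"
  using that
proof (induction w arbitrary: k rule: rev_induct)
  case Nil
  then show ?case by (simp add: empty_shape_def)
next
  case (snoc l w)
  have "std_word w" and ad: "addable (shape w) l" using snoc.prems by (auto simp: std_word_snoc)
  then have IH: "(k \<le> - int (length w) \<longrightarrow> shape w k) \<and> (int (length w) < k \<longrightarrow> \<not> shape w k)" for k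
    using snoc.IH by blast
  have "\<not> l \<le> - int (length w) - 1" using IH[of "l + 1"] ad by (auto simp: addable_def)
  moreover have "\<not> l > int (length w)" using IH[of "l"] ad by (auto simp: addable_def)
  ultimately show ?case using IH[of k] by (auto simp: shape_snoc add_cell_def)
qed

text \<open>Any removable corner can hold the largest entry. If the last letter \<open>l\<close> is
  another corner, \<open>k\<close> is already removable before \<open>l\<close> is added; bring it
  to the end there, then exchange it with \<open>l\<close>.\<close>

lemma std_word_last_removable:
  assumes "std_word w" "removable (shape w) k"
  obtains u where "std_word (u @ [k])" "shape (u @ [k]) = shape w" "length w = Suc (length u)"
  using assms
proof (induction w arbitrary: k thesis rule: rev_induct)
  case Nil
  then show ?case by (auto simp: empty_shape_def removable_def)
next
  case (snoc l w)
  have w: "std_word w" and ad: "addable (shape w) l" using snoc.prems by (auto simp: std_word_snoc)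
  show ?case
  proof (cases "k = l")
    case True
    then show ?thesis using snoc.prems by auto
  next
    case False
    have far: "l + 2 \<le> k \<or> k + 2 \<le> l"
      using removable_far[of "shape (w @ [l])" l k] False
        removable_add_cell[OF ad] snoc.prems(3) by (auto simp: shape_snoc)
    then have "removable (shape w) k"
      using snoc.prems(3) by (simp add: shape_snoc removable_add_cell_far)
    then obtain u where u: "std_word (u @ [k])" "shape (u @ [k]) = shape w"
      "length w = Suc (length u)" using snoc.IH w by metis
    have "growth (shape u) [k, l]" using u ad by (simp add: std_word_append shape_append)
    then have "growth (shape u) [l, k]" using growth_swap far by blast
    then have 1: "std_word ((u @ [l]) @ [k])" using u by (simp add: std_word_append)
    have "shape ((u @ [l]) @ [k]) = shape (w @ [l])"
      using u(2) far by (simp add: shape_append) (metis add_cell_commute)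
    then show ?thesis using 1 u(3) snoc.prems(1) by fastforce
  qed
qed

text \<open>Because corners alternate, a downward closed set of removable corners is cut off by an
  addable one. This turns a monotone sign into a comparison with the content of a new cell.\<close>

lemma ex_addable_cut:
  assumes "std_word w"
    and "\<And>c d. removable (shape w) c \<Longrightarrow> removable (shape w) d \<Longrightarrow> c < d \<Longrightarrow> g d \<Longrightarrow> g c"
  shows "\<exists>k. addable (shape w) k \<and> (\<forall>f. removable (shape w) f \<longrightarrow> g f = (f < k))"
proof -
  define n where "n = int (length w)"
  have bounds: "k \<le> - n \<Longrightarrow> shape w k" "n < k \<Longrightarrow> \<not> shape w k" for k
    using shape_bounds[OF assms(1), of k] by (auto simp: n_def)
  have rem: "- n < f \<and> f + 1 \<le> n" if "removable (shape w) f" for f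
    using that bounds(1)[of f] bounds(2)[of "f + 1"] by (force simp: removable_def)
  \<comment> \<open>The sentinel \<open>- n - 1\<close> lies below all removable corners and stands
    in when none satisfies \<open>g\<close>; the path is \<open>True\<close> at \<open>M + 1\<close>
    in either case.\<close>
  define S where "S = insert (- n - 1) {f. removable (shape w) f \<and> g f}"
  have fin: "finite S"
    by (rule finite_subset[of _ "{- n - 1..n}"]) (use rem in \<open>force simp: S_def n_def\<close>)+
  define M where "M = Max S"
  have M: "M \<in> S" using Max_in[OF fin] by (auto simp: S_def M_def)
  have Mle: "f \<le> M" if "removable (shape w) f" "g f" for f
    using Max_ge[OF fin] that by (auto simp: S_def M_def)
  have M1: "shape w (M + 1)" "M + 1 \<le> n + 1"
    using M bounds(1)[of "- n"] rem by (fastforce simp: S_def removable_def n_def)+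
  obtain k where k: "M + 1 \<le> k" "addable (shape w) k" "\<And>h. M + 1 \<le> h \<Longrightarrow> h \<le> k \<Longrightarrow> shape w h"
    using ex_addable_between[of "shape w" "M + 1" "n + 1"] M1 bounds(2)[of "n + 1"] by auto
  have "g f = (f < k)" if f: "removable (shape w) f" for f
  proof
    assume "g f"
    then show "f < k" using Mle[OF f] k(1) by simp
  next
    assume "f < k"
    \<comment> \<open>The path is constantly \<open>True\<close> from \<open>M + 1\<close> to
      \<open>k\<close>, which leaves no room for a removable corner.\<close>
    have "\<not> M + 1 \<le> f" using k(3)[of f] f \<open>f < k\<close> by (auto simp: removable_def)
    then have le: "f \<le> M" by simp
    then have "removable (shape w) M \<and> g M" using M rem[OF f] by (auto simp: S_def)
    then show "g f" using assms(2)[OF f, of M] le by (cases "f = M") auto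
  qed
  then show ?thesis using k(2) by blast
qed

text \<open>The letters \<open>x\<close>, \<open>y\<close>, \<open>z\<close> are the contents of
  \<open>i - 1\<close>, \<open>i\<close>, \<open>i + 1\<close>. Unless \<open>i\<close> has the
  median content, the entry of median content stays and the other two are exchanged; the median
  replaces the comparison of distances in the reading word.\<close>

definition dual_move :: "nat \<Rightarrow> int list \<Rightarrow> int list" where
  "dual_move i w = (let x = w ! (i - 2); y = w ! (i - 1); z = w ! i in
     if between y x z then w[i - 1 := z, i := y]
     else if between x z y then w[i - 2 := y, i - 1 := x] else w)"

definition asc :: "int list \<Rightarrow> nat \<Rightarrow> bool" where
  "asc w k \<longleftrightarrow> w ! (k - 1) < w ! k"

lemma dual_move_append:
  assumes "i < length a"
  shows "dual_move i (a @ b) = dual_move i a @ b"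
  using assms by (auto simp: dual_move_def Let_def nth_append list_update_append)

lemma dual_move_triple:
  assumes "i = length a + 2"
  shows "dual_move i (a @ x # y # z # b) =
    a @ (if between y x z then [x, z, y] else if between x z y then [y, x, z] else [x, y, z]) @ b"
  using assms
  by (auto simp: dual_move_def Let_def nth_append list_update_append numeral_2_eq_2)

lemma length_dual_move [simp]: "length (dual_move i w) = length w"
  by (simp add: dual_move_def Let_def)

lemma asc_append: "k < length a \<Longrightarrow> asc (a @ b) k = asc a k"
  by (auto simp: asc_def nth_append)

lemma asc_pair: "k = length a + 1 \<Longrightarrow> asc (a @ x # y # b) k \<longleftrightarrow> x < y"
  by (auto simp: asc_def nth_append)

lemma split_triple:
  assumes "1 < i" "i < length w"
  obtains a x y z b where "w = a @ x # y # z # b" "i = length a + 2"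
proof -
  define j where "j = i - 2"
  then have j: "i = Suc (Suc j)" using assms(1) by simp
  have d: "w ! j # w ! Suc j # w ! i # drop (Suc i) w = drop j w"
    using assms(2) j Cons_nth_drop_Suc[of j w] Cons_nth_drop_Suc[of "Suc j" w]
      Cons_nth_drop_Suc[of "Suc (Suc j)" w] by simp
  have "w = take j w @ w ! j # w ! Suc j # w ! i # drop (Suc i) w"
    unfolding d by simp
  then show ?thesis
    by (rule that) (use assms(2) j in simp)
qed

text \<open>After a cell of content \<open>k\<close>, both a cell of content \<open>k - 1\<close>
  and one of content \<open>k + 1\<close> must be added before \<open>k\<close> is addable
  again.\<close>

lemma growth_triple_distinct:
  assumes "growth e (x # y # z # b)"
  shows "x \<noteq> y \<and> y \<noteq> z \<and> x \<noteq> z"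
  using assms by (auto simp: addable_def add_cell_def split: if_splits)

lemma std_word_dual_move:
  assumes "std_word w" "1 < i" "i < length w"
  shows "std_word (dual_move i w)" "shape (dual_move i w) = shape w"
    "dual_move i (dual_move i w) = w"
    "dual_move i w = w \<longleftrightarrow> asc w (i - 1) = asc w i"
proof -
  obtain a x y z b where w: "w = a @ x # y # z # b" "i = length a + 2"
    using split_triple assms by blast
  note dm = dual_move_triple[of i a, OF w(2)]
  have g: "growth (shape a) (x # y # z # b)" "std_word a"
    using assms(1) w by (auto simp: std_word_append)
  have dist: "x \<noteq> y \<and> y \<noteq> z \<and> x \<noteq> z" using growth_triple_distinct g(1) by blast
  have sw: "growth (shape a) (x # z # y # b)" "shape (a @ x # z # y # b) = shape w" if "between y x z"
  proof -
    \<comment> \<open>A letter strictly between \<open>y\<close> and \<open>z\<close> forces a gap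
      of two, so their cells can be added in either order.\<close>
    have far: "y + 2 \<le> z \<or> z + 2 \<le> y" using that by (auto simp: between_def)
    show "growth (shape a) (x # z # y # b)" using g(1) growth_swap[OF far] by simp
    show "shape (a @ x # z # y # b) = shape w"
      using add_cell_commute[OF far] by (simp add: w shape_append)
  qed
  have sw': "growth (shape a) (y # x # z # b)" "shape (a @ y # x # z # b) = shape w" if "between x z y"
  proof -
    have far: "y + 2 \<le> x \<or> x + 2 \<le> y" using that by (auto simp: between_def)
    show "growth (shape a) (y # x # z # b)" using g(1) growth_swap[OF far] by blast
    show "shape (a @ y # x # z # b) = shape w"
      using add_cell_commute[OF far] by (simp add: w shape_append)
  qed
  show "std_word (dual_move i w)"
    using sw sw' g assms(1) by (auto simp: w(1) dm std_word_append)
  show "shape (dual_move i w) = shape w"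
    using sw sw' by (auto simp: w(1) dm)
  show "dual_move i (dual_move i w) = w"
    by (auto simp: w(1) dm between_def)
  have "asc w (i - 1) \<longleftrightarrow> x < y" using asc_pair[of "i - 1" a x y "z # b"] w by simp
  moreover have "asc w i \<longleftrightarrow> y < z" using asc_pair[of i "a @ [x]" y z b] w by simp
  ultimately show "dual_move i w = w \<longleftrightarrow> asc w (i - 1) = asc w i"
    using dist by (auto simp: w(1) dm between_def)
qed

section \<open>Connectivity and rigidity under dual equivalence moves\<close>

definition moves :: "nat \<Rightarrow> nat list \<Rightarrow> bool" where
  "moves m is \<longleftrightarrow> set is \<subseteq> {2..<m}"

abbreviation dual_moves :: "nat list \<Rightarrow> int list \<Rightarrow> int list" where
  "dual_moves is w \<equiv> fold dual_move is w"

lemma length_dual_moves [simp]: "length (dual_moves is w) = length w"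
  by (induction "is" arbitrary: w) auto

lemma dual_moves_append:
  assumes "moves m is" "m \<le> length a"
  shows "dual_moves is (a @ b) = dual_moves is a @ b"
  using assms by (induction "is" arbitrary: a) (auto simp: moves_def dual_move_append)

lemma moves_mono: "moves m is \<Longrightarrow> m \<le> m' \<Longrightarrow> moves m' is"
  by (auto simp: moves_def)

text \<open>Induction on the length. If the last letters \<open>c\<close> and \<open>d\<close>
  differ, both are corners of the final shape, and some \<open>f\<close> between them can be made
  the third letter from the end. One move turns \<open>z f d c\<close> into \<open>z f c d\<close>;
  the induction hypothesis connects \<open>u\<close> to the former and the latter to
  \<open>w\<close>.\<close>

lemma std_word_connected:
  assumes "std_word u" "std_word w" "shape u = shape w" "length u = length w"
  obtains "is" where "moves (length u) is" "dual_moves is u = w"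
proof -
  have "\<exists>is. moves n is \<and> dual_moves is u = w"
    if "std_word u" "std_word w" "shape u = shape w" "length u = n" "length w = n" for n u w
    using that
  proof (induction n arbitrary: u w)
    case 0
    then show ?case by (intro exI[of _ "[]"]) (auto simp: moves_def)
  next
    case (Suc n)
    obtain u' c where uc: "u = u' @ [c]" using Suc.prems by (cases u rule: rev_cases) auto
    obtain x d where x: "w = x @ [d]" using Suc.prems by (cases w rule: rev_cases) auto
    have len: "length u' = n" "length x = n" using Suc.prems x uc by auto
    have u: "std_word u'" "addable (shape u') c" and xs: "std_word x" "addable (shape x) d"
      using Suc.prems x uc by (auto simp: std_word_snoc)
    have sh: "add_cell (shape u') c = add_cell (shape x) d"
      using Suc.prems x uc by (simp add: shape_snoc)
    show ?case
    proof (cases "c = d")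
      case True
      have "shape u' = shape x" using add_cell_inj sh True u(2) xs(2) by blast
      then obtain ms where ms: "moves n ms" "dual_moves ms u' = x"
        using Suc.IH[of u' x] u xs len by metis
      then have "dual_moves ms u = w" using dual_moves_append[OF ms(1)] x uc True len by simp
      then show ?thesis using ms moves_mono by (metis le_SucI order_refl)
    next
      case False
      have rem: "removable (shape w) c" "removable (shape w) d"
        using removable_add_cell u(2) xs(2) sh x by (metis shape_snoc)+
      have far: "c + 2 \<le> d \<or> d + 2 \<le> c"
        using removable_far[OF rem False] .
      have "removable (shape u') d"
        using rem(2) sh x far by (metis shape_snoc removable_add_cell_far)
      then obtain y where y: "std_word (y @ [d])" "shape (y @ [d]) = shape u'" "length u' = Suc (length y)"
        using std_word_last_removable u(1) by metis
      have add: "addable (shape y) d" "addable (shape y) c"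
        using y u(2) addable_add_cell_far[of d c "shape y"] far by (auto simp: std_word_snoc shape_snoc)
      obtain f where f: "removable (shape y) f" "between d f c"
        using addable_separated[OF add] False by metis
      have ys: "std_word y" using y by (simp add: std_word_snoc)
      obtain z where z: "std_word (z @ [f])" "shape (z @ [f]) = shape y" "length y = Suc (length z)"
        using std_word_last_removable ys f(1) by metis
      have st1: "std_word ((z @ [f]) @ [d])" "shape ((z @ [f]) @ [d]) = shape u'"
        unfolding std_word_snoc[of "z @ [f]"] shape_snoc[of "z @ [f]"] z(2)
        using z(1) add y(2) by (simp_all add: shape_snoc)
      have st2: "std_word ((z @ [f]) @ [c])"
        unfolding std_word_snoc[of "z @ [f]"] z(2) using z(1) add by simp
      have "add_cell (shape ((z @ [f]) @ [c])) d = add_cell (shape x) d"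
        unfolding shape_snoc[of "z @ [f]"] z(2) add_cell_commute[OF far]
        using sh y(2) by (simp add: shape_snoc)
      moreover have "addable (shape ((z @ [f]) @ [c])) d"
        unfolding shape_snoc[of "z @ [f]"] z(2) using add addable_add_cell_far far by metis
      ultimately have sh2: "shape ((z @ [f]) @ [c]) = shape x" using add_cell_inj xs(2) by blast
      have len': "length ((z @ [f]) @ [d]) = n" "length ((z @ [f]) @ [c]) = n" using y z len by auto
      obtain ms where ms: "moves n ms" "dual_moves ms u' = (z @ [f]) @ [d]"
        using Suc.IH[OF u(1) st1(1) st1(2)[symmetric] len(1) len'(1)] by blast
      obtain ms' where ms': "moves n ms'" "dual_moves ms' ((z @ [f]) @ [c]) = x"
        using Suc.IH[OF st2 xs(1) sh2 len'(2) len(2)] by blast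
      have "dual_moves ms u = z @ [f, d, c]"
        using dual_moves_append[OF ms(1)] ms(2) len uc by simp
      moreover have "dual_move n (z @ [f, d, c]) = z @ [f, c, d]"
        using dual_move_triple[of n z f d c "[]"] f(2) len' by simp
      moreover have "dual_moves ms' (z @ [f, c, d]) = w"
        using dual_moves_append[OF ms'(1), of "z @ [f, c]" "[d]"] ms'(2) x len' by simp
      ultimately have "dual_moves (ms @ n # ms') u = w" by simp
      moreover have "moves (Suc n) (ms @ n # ms')"
        using ms(1) ms'(1) len' by (auto simp: moves_def)
      ultimately show ?thesis by blast
    qed
  qed
  then show ?thesis using that assms by metis
qed

text \<open>Rigidity: the ascents seen along all moves determine the word, with no prior knowledge
  of its shape. Once the prefixes agree, different last letters are told apart by moving a removable
  corner between them to the place just before.\<close>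

lemma std_word_eqI:
  assumes "std_word u" "std_word w" "length u = m" "length w = m"
    and "\<And>ms k. moves m ms \<Longrightarrow> 1 \<le> k \<Longrightarrow> k < m \<Longrightarrow> asc (dual_moves ms u) k = asc (dual_moves ms w) k"
  shows "u = w"
  using assms
proof (induction m arbitrary: u w)
  case 0
  then show ?case by simp
next
  case (Suc m)
  obtain u' c where u: "u = u' @ [c]" using Suc.prems by (cases u rule: rev_cases) auto
  obtain w' d where w: "w = w' @ [d]" using Suc.prems by (cases w rule: rev_cases) auto
  have len: "length u' = m" "length w' = m" using Suc.prems u w by auto
  have st: "std_word u'" "addable (shape u') c" "std_word w'" "addable (shape w') d"
    using Suc.prems u w by (auto simp: std_word_snoc)
  have "u' = w'"
  proof (rule Suc.IH)
    fix ms k assume k: "moves m ms" "1 \<le> k" "k < m"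
    have "asc (dual_moves ms u) k = asc (dual_moves ms w) k"
      using Suc.prems(5) k moves_mono by simp
    then show "asc (dual_moves ms u') k = asc (dual_moves ms w') k"
      using k len by (simp add: u w dual_moves_append asc_append)
  qed (use st len in auto)
  moreover have "c = d"
  proof (rule ccontr)
    assume "c \<noteq> d"
    then obtain f where f: "removable (shape u') f" "between c f d"
      using addable_separated st \<open>u' = w'\<close> by metis
    obtain z where z: "std_word (z @ [f])" "shape (z @ [f]) = shape u'" "length u' = Suc (length z)"
      using std_word_last_removable st(1) f(1) by metis
    obtain ms where ms: "moves m ms" "dual_moves ms u' = z @ [f]"
      using std_word_connected[of u' "z @ [f]"] st z len by (metis length_append_singleton)
    have "dual_moves ms u = z @ [f, c]" "dual_moves ms w = z @ [f, d]"
      using dual_moves_append[OF ms(1)] ms(2) len u w \<open>u' = w'\<close> by simp_all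
    moreover have "asc (dual_moves ms u) m = asc (dual_moves ms w) m"
      using Suc.prems(5)[of ms m] ms moves_mono len z by simp
    moreover have "m = length z + 1" using z len by simp
    ultimately show False
      using asc_pair[of m z f _ "[]"] f(2) unfolding between_def by (metis order_less_asym)
  qed
  ultimately show ?case using u w by simp
qed

section \<open>The axioms of dual equivalence graphs\<close>

lemma deg_edge:
  assumes "deg n N V s E" "{x, y} \<in> E i" "1 < i" "i < n"
  shows "x \<in> V" "y \<in> V" "x \<noteq> y"
proof -
  have "E i \<subseteq> {{x, y} | x y. x \<in> V \<and> y \<in> V \<and> x \<noteq> y}"
    using assms by (simp add: deg_def scg_def)
  then show "x \<in> V" "y \<in> V" "x \<noteq> y" using assms(2) by (auto simp: doubleton_eq_iff)
qed

lemma deg_edge_iff: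
  assumes "deg n N V s E" "w \<in> V" "1 < i" "i < n"
  shows "(\<exists>x. {w, x} \<in> E i) \<longleftrightarrow> s w (i - 1) \<noteq> s w i"
  using assms by (simp add: deg_def)

lemma deg_sign_flip:
  assumes "deg n N V s E" "{w, x} \<in> E i" "1 < i" "i < n"
  shows "s w (i - 1) \<noteq> s x (i - 1)" "s w i \<noteq> s x i"
  using assms by (simp_all add: deg_def)

lemma deg_sign_keep:
  assumes "deg n N V s E" "{w, x} \<in> E i" "1 < i" "i < n" "1 \<le> h" "h < N" "h + 2 < i \<or> i + 1 < h"
  shows "s w h = s x h"
  using assms by (simp add: deg_def)

lemma deg_sign_left:
  assumes "deg n N V s E" "{w, x} \<in> E i" "3 \<le> i" "i < n" "s w (i - 2) \<noteq> s x (i - 2)"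
  shows "s w (i - 2) \<noteq> s w (i - 1)"
proof -
  have "\<forall>i w x. 1 < i \<and> i < n \<and> {w, x} \<in> E i \<longrightarrow>
      (3 \<le> i \<and> s w (i - 2) \<noteq> s x (i - 2) \<longrightarrow> s w (i - 2) \<noteq> s w (i - 1)) \<and>
      (i + 1 < N \<and> s w (i + 1) \<noteq> s x (i + 1) \<longrightarrow> s w (i + 1) \<noteq> s w i)"
    using assms(1) unfolding deg_def by (elim conjE)
  from this[rule_format, of i w x] show ?thesis using assms(2-) by simp
qed

lemma deg_sign_right:
  assumes "deg n N V s E" "{w, x} \<in> E i" "1 < i" "i < n" "i + 1 < N" "s w (i + 1) \<noteq> s x (i + 1)"
  shows "s w (i + 1) \<noteq> s w i"
proof -
  have "\<forall>i w x. 1 < i \<and> i < n \<and> {w, x} \<in> E i \<longrightarrow>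
      (3 \<le> i \<and> s w (i - 2) \<noteq> s x (i - 2) \<longrightarrow> s w (i - 2) \<noteq> s w (i - 1)) \<and>
      (i + 1 < N \<and> s w (i + 1) \<noteq> s x (i + 1) \<longrightarrow> s w (i + 1) \<noteq> s w i)"
    using assms(1) unfolding deg_def by (elim conjE)
  from this[rule_format, of i w x] show ?thesis using assms(2-) by simp
qed

lemma deg_commute:
  assumes "deg n N V s E" "{w, x} \<in> E i" "{x, y} \<in> E j" "1 < i" "i < n" "1 < j" "j < n"
    "i + 3 \<le> j \<or> j + 3 \<le> i"
  shows "\<exists>v. {w, v} \<in> E j \<and> {v, y} \<in> E i"
proof -
  have "\<forall>i j w x y. 1 < i \<and> i < n \<and> 1 < j \<and> j < n \<and> (i + 3 \<le> j \<or> j + 3 \<le> i) \<and>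
        {w, x} \<in> E i \<and> {x, y} \<in> E j \<longrightarrow> (\<exists>v. {w, v} \<in> E j \<and> {v, y} \<in> E i)"
    using assms(1) unfolding deg_def by (elim conjE)
  from this[rule_format, of i j w x y] show ?thesis using assms(2-) by simp
qed

lemma deg_one_edge:
  assumes "deg n N V s E" "conn {2..i} E x y" "1 < i" "i < n" "x \<in> V" "y \<in> V"
  shows "conn {2..<i} E x y \<or> (\<exists>a b. {a, b} \<in> E i \<and> conn {2..<i} E x a \<and> conn {2..<i} E b y)"
proof -
  have "\<forall>i x y. 1 < i \<and> i < n \<and> x \<in> V \<and> y \<in> V \<and> conn {2..i} E x y \<longrightarrow>
      conn {2..<i} E x y \<or>
      (\<exists>a b. {a, b} \<in> E i \<and> conn {2..<i} E x a \<and> conn {2..<i} E b y)"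
    using assms(1) unfolding deg_def by (elim conjE)
  from this[rule_format, of i x y] show ?thesis using assms(2-) by simp
qed

section \<open>Connectivity and the local components\<close>

lemma conn_refl [simp]: "conn K E x x"
  by (simp add: conn_def)

lemma conn_trans: "conn K E x y \<Longrightarrow> conn K E y z \<Longrightarrow> conn K E x z"
  by (simp add: conn_def)

lemma conn_edge: "{x, y} \<in> E i \<Longrightarrow> i \<in> K \<Longrightarrow> conn K E x y"
  by (auto simp: conn_def)

lemma conn_sym: "conn K E x y \<Longrightarrow> conn K E y x"
  unfolding conn_def
proof (induction rule: rtranclp_induct)
  case (step y z)
  then show ?case by (metis (mono_tags, lifting) converse_rtranclp_into_rtranclp insert_commute)
qed simp

lemma conn_mono: "conn K E x y \<Longrightarrow> K \<subseteq> K' \<Longrightarrow> conn K' E x y"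
  unfolding conn_def by (erule rtranclp_mono[THEN predicate2D, rotated]) blast

text \<open>In every alternative for a two-coloured component there is at most one edge of each
  colour. So an edge merely known to exist is identified with a given one.\<close>

lemma deg_unique_edges:
  assumes "deg n N V s E" "2 < i" "i < n" "{w, p} \<in> E (i - 1)" "{w, x} \<in> E i"
    and "y \<in> V" "conn {i - 1, i} E w y"
  shows "{y, q} \<in> E i \<Longrightarrow> {y, q} = {w, x}" "{y, q} \<in> E (i - 1) \<Longrightarrow> {y, q} = {w, p}"
proof -
  define C where "C = component {i - 1, i} V E w"
  have i: "1 < i - 1" "i - 1 < n" "1 < i" "i \<noteq> i - 1" using assms(2,3) by auto
  then have V: "w \<in> V" "p \<in> V" "x \<in> V"
    using deg_edge[OF assms(1,4)] deg_edge[OF assms(1,5)] assms(3) by blast+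
  have "conn {i - 1, i} E w p" "conn {i - 1, i} E w x"
    using assms by (auto intro!: conn_edge)
  then have wpx: "w \<in> C" "p \<in> C" "x \<in> C" "y \<in> C"
    using V assms(6,7) by (auto simp: C_def component_def)
  have qC: "q \<in> C" if "{y, q} \<in> E j" "j \<in> {i - 1, i}" for j
  proof -
    have "1 < j" "j < n" using that(2) i assms(3) by auto
    then have "q \<in> V" using deg_edge(2)[OF assms(1) that(1)] by blast
    moreover have "conn {i - 1, i} E y q" using conn_edge that by metis
    ultimately show ?thesis
      using conn_trans[OF assms(7)] by (simp add: C_def component_def)
  qed
  have CE: "(i, {w, x}) \<in> cedges {i - 1, i} E C" "(i - 1, {w, p}) \<in> cedges {i - 1, i} E C"
    using assms(4,5) wpx by (simp_all add: cedges_def)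
  have CEq: "(j, {y, q}) \<in> cedges {i - 1, i} E C" if "{y, q} \<in> E j" "j \<in> {i - 1, i}" for j
    using that wpx qC[OF that] by (simp add: cedges_def)
  have "\<forall>i v. 2 < i \<and> i < n \<and> v \<in> V \<longrightarrow> ax4_two i E (component {i - 1, i} V E v)"
    using assms(1) unfolding deg_def by (elim conjE)
  then have "ax4_two i E C" using assms(2,3) V(1) unfolding C_def by blast
  then have "\<exists>e f. cedges {i - 1, i} E C \<subseteq> {(i - 1, e), (i, f)}"
    unfolding ax4_two_def Let_def by (elim disjE exE conjE) auto
  then obtain e f where ef: "cedges {i - 1, i} E C \<subseteq> {(i - 1, e), (i, f)}" by blast
  have "{w, x} = f" "{w, p} = e" using subsetD[OF ef CE(1)] subsetD[OF ef CE(2)] i(4) by simp_all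
  then show "{y, q} \<in> E i \<Longrightarrow> {y, q} = {w, x}" "{y, q} \<in> E (i - 1) \<Longrightarrow> {y, q} = {w, p}"
    using subsetD[OF ef CEq[of i]] subsetD[OF ef CEq[of "i - 1"]] i(4) by simp_all
qed

text \<open>Two \<open>i\<close>-edges hanging from the ends of an \<open>(i - 2)\<close>-edge occur
  only in the components with five or six vertices. In the former one of them is a double edge,
  which is excluded; in the latter they form a four-cycle.\<close>

lemma deg_square:
  assumes "deg n N V s E" "3 < i" "i < n"
    and e: "{w, w'} \<in> E (i - 2)" "{w, x} \<in> E i" "{w', x'} \<in> E i"
    and n: "{w, x} \<notin> E (i - 1)" "{w', x'} \<notin> E (i - 1)"
  shows "{x, x'} \<in> E (i - 2)"
proof -
  define K where "K = {i - 2, i - 1, i}"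
  define C where "C = component K V E w"
  have "1 < i - 2" "i - 2 < n" "1 < i" using assms(2,3) by auto
  then have V: "w \<in> V" "w' \<in> V" "x \<in> V" "x' \<in> V" "w \<noteq> w'" "w \<noteq> x" "w' \<noteq> x'"
    using deg_edge[OF assms(1) e(1)] deg_edge[OF assms(1) e(2)] deg_edge[OF assms(1) e(3)] assms(3)
    by blast+
  have "conn K E w w'" "conn K E w x" "conn K E w' x'"
    using assms by (auto intro!: conn_edge simp: K_def)
  then have "w \<in> C" "w' \<in> C" "x \<in> C" "x' \<in> C"
    using V conn_trans[of K E w w' x'] by (auto simp: C_def component_def)
  then have CE: "(i - 2, {w, w'}) \<in> cedges K E C" "(i, {w, x}) \<in> cedges K E C"
      "(i, {w', x'}) \<in> cedges K E C"
      "(i - 1, {w, x}) \<notin> cedges K E C" "(i - 1, {w', x'}) \<notin> cedges K E C"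
    using e n by (auto simp: cedges_def K_def)
  have ne: "i \<noteq> i - 1" "i \<noteq> i - 2" "i - 1 \<noteq> i - 2" using assms(2) by simp_all
  have "\<forall>i v. 3 < i \<and> i < n \<and> v \<in> V \<longrightarrow> ax4_three i E (component {i - 2, i - 1, i} V E v)"
    using assms(1) unfolding deg_def by (elim conjE)
  then have "ax4_three i E C" using assms(2,3) V(1) unfolding C_def K_def by blast
  then have "(i - 2, {x, x'}) \<in> cedges K E C"
    unfolding ax4_three_def Let_def K_def[symmetric]
  proof (elim disjE exE conjE)
    fix p q r t
    assume CE': "cedges K E C = {(i - 2, {p, q}), (i - 1, {q, r}), (i, {r, t})}"
      and "C = {p, q, r, t}" "card C = 4"
    then have "distinct [p, q, r, t]" by (intro card_distinct) simp
    then show ?thesis using CE V ne unfolding CE' by (auto simp: doubleton_eq_iff)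
  next
    fix a b c d f
    assume CE': "cedges K E C = {(i - 2, {a, b}), (i - 1, {a, b}), (i, {b, c}), (i - 2, {c, d}),
              (i - 1, {d, f}), (i, {d, f})}"
      and "C = {a, b, c, d, f}" "card C = 5"
    then have "distinct [a, b, c, d, f]" by (intro card_distinct) simp
    then show ?thesis using CE V ne unfolding CE' by (auto simp: doubleton_eq_iff)
  next
    fix a b c d f g
    assume CE': "cedges K E C = {(i - 1, {a, b}), (i - 2, {b, c}), (i, {b, d}), (i, {c, f}),
              (i - 2, {d, f}), (i - 1, {f, g})}"
      and "C = {a, b, c, d, f, g}" "card C = 6"
    then have "distinct [a, b, c, d, f, g]" by (intro card_distinct) simp
    then show ?thesis using CE V ne unfolding CE' by (auto simp: doubleton_eq_iff)
  qed (use CE in auto)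
  then show ?thesis by (simp add: cedges_def)
qed

lemma deg_restrict:
  assumes "deg (Suc n) (Suc n) V s E"
  shows "deg n n V s E"
  using assms unfolding deg_def scg_def
  apply (elim conjE)
  apply (intro conjI)
  subgoal premises p by (rule p(1))
  subgoal premises p using p(2) less_SucI by blast
  subgoal premises p by simp
  subgoal premises p using p(4) less_SucI by blast
  subgoal premises p using p(5) less_SucI by blast
  subgoal premises p using p(6) less_SucI by blast
  subgoal premises p using p(7) less_SucI by blast
  subgoal premises p using p(8) less_SucI by blast
  subgoal premises p using p(9) less_SucI by blast
  subgoal premises p using p(10) less_SucI by blast
  done

section \<open>Edges of the largest colour\<close>

text \<open>The induction step once the letter for \<open>n + 1\<close> has been appended: all signs
  and the colours below \<open>n\<close> already agree with the words, and only the colour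
  \<open>n\<close> is open.\<close>

locale word_labelling =
  fixes n :: nat and V :: "'a set" and s :: "'a \<Rightarrow> nat \<Rightarrow> bool" and E :: "nat \<Rightarrow> 'a set set"
    and \<Psi> :: "'a \<Rightarrow> int list"
  assumes deg: "deg (Suc n) (Suc n) V s E"
    and std: "\<And>v. v \<in> V \<Longrightarrow> std_word (\<Psi> v)"
    and len: "\<And>v. v \<in> V \<Longrightarrow> length (\<Psi> v) = Suc n"
    and sign: "\<And>v k. v \<in> V \<Longrightarrow> 1 \<le> k \<Longrightarrow> k \<le> n \<Longrightarrow> s v k = asc (\<Psi> v) k"
    and edge: "\<And>i x y. 1 < i \<Longrightarrow> i < n \<Longrightarrow> {x, y} \<in> E i \<Longrightarrow> \<Psi> y = dual_move i (\<Psi> x)"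
    and inj: "\<And>x y. x \<in> V \<Longrightarrow> y \<in> V \<Longrightarrow> conn {2..<n} E x y \<Longrightarrow> \<Psi> x = \<Psi> y \<Longrightarrow> x = y"
begin

section \<open>Transporting edges of colour \<open>n\<close> and comparing their ends\<close>

lemma edge_in_V:
  assumes "{x, y} \<in> E i" "1 < i" "i \<le> n"
  shows "x \<in> V" "y \<in> V" "x \<noteq> y"
  using deg_edge[OF deg assms(1,2)] assms(3) by auto

lemma edge_iff:
  assumes "v \<in> V" "1 < i" "i \<le> n"
  shows "(\<exists>x. {v, x} \<in> E i) \<longleftrightarrow> asc (\<Psi> v) (i - 1) \<noteq> asc (\<Psi> v) i"
  using deg_edge_iff[OF deg assms(1,2)] sign[OF assms(1), of "i - 1"] sign[OF assms(1), of i] assms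
  by auto

lemma edge_iff_move:
  assumes "v \<in> V" "1 < i" "i \<le> n"
  shows "(\<exists>x. {v, x} \<in> E i) \<longleftrightarrow> dual_move i (\<Psi> v) \<noteq> \<Psi> v"
  using edge_iff[OF assms] std_word_dual_move(4)[OF std[OF assms(1)] assms(2)] len[OF assms(1)] assms(3)
  by auto

lemma lift_move:
  assumes "v \<in> V" "1 < i" "i < n" "dual_move i (\<Psi> v) \<noteq> \<Psi> v"
  obtains y where "{v, y} \<in> E i" "\<Psi> y = dual_move i (\<Psi> v)"
  using edge_iff_move[OF assms(1,2)] edge[OF assms(2,3)] assms by auto

text \<open>If the move is effective at \<open>w\<close>, axiom 5 carries the \<open>n\<close>-edge
  along the \<open>i\<close>-edge. If it is trivial at \<open>w\<close>, it is trivial at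
  \<open>x\<close> too, since by axiom 2 an \<open>n\<close>-edge keeps the signs
  \<open>i - 1\<close> and \<open>i\<close>. Both need \<open>i < n - 2\<close>.\<close>

lemma transport_move:
  assumes "{w, x} \<in> E n" "1 < i" "i < n - 2"
  shows "\<exists>w' x'. {w', x'} \<in> E n \<and> \<Psi> w' = dual_move i (\<Psi> w) \<and> \<Psi> x' = dual_move i (\<Psi> x) \<and>
    conn {2..<n} E w w' \<and> conn {2..<n} E x x'"
proof -
  have n: "1 < n" "n < Suc n" "i < n" "i < Suc n" "i + 2 < n" "i + 3 \<le> n" using assms by auto
  have V: "w \<in> V" "x \<in> V" using edge_in_V[OF assms(1) n(1)] by auto
  show ?thesis
  proof (cases "dual_move i (\<Psi> w) = \<Psi> w")
    case True
    have "s w (i - 1) = s x (i - 1)"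
      by (rule deg_sign_keep[OF deg assms(1) n(1,2)]) (use assms(2) n in auto)
    moreover have "s w i = s x i"
      by (rule deg_sign_keep[OF deg assms(1) n(1,2)]) (use assms(2) n in auto)
    ultimately have "asc (\<Psi> w) (i - 1) = asc (\<Psi> x) (i - 1)" "asc (\<Psi> w) i = asc (\<Psi> x) i"
      using sign V assms(2) n by auto
    then have "dual_move i (\<Psi> x) = \<Psi> x"
      using True std_word_dual_move(4)[OF std[OF V(1)] assms(2)]
        std_word_dual_move(4)[OF std[OF V(2)] assms(2)] len V n by auto
    then show ?thesis using True assms(1) by (intro exI[of _ w] exI[of _ x]) simp
  next
    case False
    then obtain w' where w': "{w, w'} \<in> E i" "\<Psi> w' = dual_move i (\<Psi> w)"
      by (rule lift_move[OF V(1) assms(2) n(3)])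
    have "{w', w} \<in> E i" using w' by (simp add: insert_commute)
    then obtain v where v: "{w', v} \<in> E n" "{v, x} \<in> E i"
      using deg_commute[OF deg _ assms(1) assms(2) n(4) n(1,2)] n(6) by blast
    then have xv: "{x, v} \<in> E i" by (simp add: insert_commute)
    have "i \<in> {2..<n}" using assms by auto
    then have "conn {2..<n} E w w'" "conn {2..<n} E x v"
      using w'(1) xv by (auto intro: conn_edge)
    then show ?thesis using w'(2) v(1) edge[OF assms(2) n(3) xv] by blast
  qed
qed

lemma transport_moves:
  assumes "{w, x} \<in> E n" "moves (n - 2) ms"
  shows "\<exists>w' x'. {w', x'} \<in> E n \<and> \<Psi> w' = dual_moves ms (\<Psi> w) \<and> \<Psi> x' = dual_moves ms (\<Psi> x) \<and>
    conn {2..<n} E w w' \<and> conn {2..<n} E x x'"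
  using assms
proof (induction ms arbitrary: w x)
  case Nil
  then show ?case by (intro exI[of _ w] exI[of _ x]) simp
next
  case (Cons i ms)
  have i: "1 < i" "i < n - 2" "moves (n - 2) ms" using Cons.prems by (auto simp: moves_def)
  then obtain w1 x1 where 1: "{w1, x1} \<in> E n" "\<Psi> w1 = dual_move i (\<Psi> w)"
    "\<Psi> x1 = dual_move i (\<Psi> x)" "conn {2..<n} E w w1" "conn {2..<n} E x x1"
    using transport_move[OF Cons.prems(1) i(1,2)] by blast
  obtain w' x' where "{w', x'} \<in> E n" "\<Psi> w' = dual_moves ms (\<Psi> w1)"
    "\<Psi> x' = dual_moves ms (\<Psi> x1)" "conn {2..<n} E w1 w'" "conn {2..<n} E x1 x'"
    using Cons.IH[OF 1(1) i(3)] by blast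
  then show ?case using 1 conn_trans by (intro exI[of _ w'] exI[of _ x']) auto
qed

text \<open>Each rearrangement of the first \<open>n - 2\<close> letters can be performed at both
  ends at once, and the ends of an \<open>n\<close>-edge share all signs below \<open>n - 2\<close>.
  Rigidity then makes the prefixes equal, even if the ends lie in different lower
  components.\<close>

lemma edge_common_prefix:
  assumes "{w, x} \<in> E n" "1 < n"
  obtains a y z t y' z' t' where "\<Psi> w = a @ [y, z, t]" "\<Psi> x = a @ [y', z', t']" "n = length a + 2"
proof -
  have V: "w \<in> V" "x \<in> V" using edge_in_V[OF assms] by auto
  have *: "\<exists>a y z t. \<Psi> v = a @ [y, z, t] \<and> n = length a + 2" if v: "v \<in> V" for v
  proof -
    obtain a y z t b where d: "\<Psi> v = a @ y # z # t # b" "n = length a + 2"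
      by (rule split_triple[of n "\<Psi> v"]) (use len[OF v] assms(2) in auto)
    then have "b = []" using len[OF v] by simp
    then show ?thesis using d by blast
  qed
  obtain a y z t where w: "\<Psi> w = a @ [y, z, t]" "n = length a + 2" using * V by blast
  obtain a' y' z' t' where x: "\<Psi> x = a' @ [y', z', t']" "n = length a' + 2" using * V by blast
  have "a = a'"
  proof (rule std_word_eqI)
    show "std_word a" "std_word a'"
      using std[OF V(1)] std[OF V(2)] w x by (simp_all add: std_word_append)
    show "length a = n - 2" "length a' = n - 2" using w x by simp_all
    fix ms k assume ms: "moves (n - 2) ms" and k: "1 \<le> k" "k < n - 2"
    obtain w' x' where e: "{w', x'} \<in> E n" "\<Psi> w' = dual_moves ms (\<Psi> w)"
      "\<Psi> x' = dual_moves ms (\<Psi> x)"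
      using transport_moves[OF assms(1) ms] by blast
    have V': "w' \<in> V" "x' \<in> V" using edge_in_V[OF e(1) assms(2)] by auto
    have "s w' k = s x' k"
      by (rule deg_sign_keep[OF deg e(1) assms(2)]) (use k in auto)
    moreover have "s w' k = asc (dual_moves ms a) k"
      using sign[OF V'(1), of k] k w e dual_moves_append[OF ms] by (simp add: asc_append)
    moreover have "s x' k = asc (dual_moves ms a') k"
      using sign[OF V'(2), of k] k x e dual_moves_append[OF ms] by (simp add: asc_append)
    ultimately show "asc (dual_moves ms a) k = asc (dual_moves ms a') k" by simp
  qed
  then show ?thesis using that w x by blast
qed

text \<open>The normalisation used below: a corner chosen as probe is brought to the end of the
  common prefix, while the last three letters stay the same at both ends.\<close>

lemma transport_prefix:
  assumes "{w, x} \<in> E n" "\<Psi> w = a @ p" "\<Psi> x = a @ p'" "length a = n - 2"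
    and "std_word a" "std_word u" "shape u = shape a" "length u = length a"
  obtains w' x' where "{w', x'} \<in> E n" "\<Psi> w' = u @ p" "\<Psi> x' = u @ p'"
    "conn {2..<n} E w w'" "conn {2..<n} E x x'"
proof -
  obtain ms where ms: "moves (n - 2) ms" "dual_moves ms a = u"
    using std_word_connected[OF assms(5,6) assms(7,8)[symmetric]] assms(4) by metis
  then show ?thesis
    using transport_moves[OF assms(1) ms(1)] dual_moves_append[OF ms(1)] assms that by auto
qed

text \<open>By axiom 1 the last two signs differ at an end of an \<open>n\<close>-edge, so the
  middle one of the last three letters is not their median. Two cases remain, according to whether
  \<open>n + 1\<close> should be fixed or moved.\<close>

lemma sign_edge:
  assumes "{w, x} \<in> E n" "1 < n" "\<Psi> w = a @ [y, z, t]" "n = length a + 2"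
  shows "(y < z) \<noteq> (z < t)" "y \<noteq> z" "z \<noteq> t" "y \<noteq> t" "s w (n - 1) = (y < z)" "s w n = (z < t)"
    "between z y t \<or> between y t z"
proof -
  have V: "w \<in> V" using edge_in_V[OF assms(1,2)] by auto
  have "asc (\<Psi> w) (n - 1) = (y < z)" using asc_pair[of "n - 1" a y z "[t]"] assms by simp
  moreover have "asc (\<Psi> w) n = (z < t)" using asc_pair[of n "a @ [y]" z t "[]"] assms by simp
  ultimately show *: "s w (n - 1) = (y < z)" "s w n = (z < t)" "(y < z) \<noteq> (z < t)"
    using sign[OF V, of "n - 1"] sign[OF V, of n] edge_iff[OF V assms(2)] assms(1,2) by auto
  show **: "y \<noteq> z" "z \<noteq> t" "y \<noteq> t"
    using std[OF V] growth_triple_distinct[of "shape a" y z t "[]"] assms(3)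
    by (simp_all add: std_word_append)
  show "between z y t \<or> between y t z" using *(3) ** by (auto simp: between_def)
qed

text \<open>By commutation, \<open>n - 2\<close> may be assumed to lie between \<open>n - 1\<close> and \<open>n\<close>, where the
  \<open>n\<close>-edge is forced to coincide with the \<open>(n - 1)\<close>-edge.\<close>
lemma edge_last_fixed:
  assumes "{w, x} \<in> E n" "1 < n" "\<Psi> w = a @ [y, z, t]" "n = length a + 2" "between y t z"
  shows "\<Psi> x = a @ [z, y, t]" "conn {2..<n} E w x"
proof -
  have V: "w \<in> V" "x \<in> V" using edge_in_V[OF assms(1,2)] by auto
  obtain y' z' t' where x: "\<Psi> x = a @ [y', z', t']"
    using edge_common_prefix[OF assms(1,2)] assms(3,4) by (metis add_right_cancel append_eq_append_conv)
  have g: "std_word a" "growth (shape a) [y, z, t]" using std[OF V(1)] assms(3) by (auto simp: std_word_append)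
  have far: "y + 2 \<le> z \<or> z + 2 \<le> y" "y \<noteq> z" using assms(5) by (auto simp: between_def)
  then have "addable (shape a) y" "addable (shape a) z" using g(2) by (auto simp: addable_add_cell_far)
  then obtain f where f: "removable (shape a) f" "between y f z" using addable_separated far(2) by metis
  obtain u where u: "std_word (u @ [f])" "shape (u @ [f]) = shape a" "length a = Suc (length u)"
    using std_word_last_removable g(1) f(1) by metis
  obtain w' x' where e: "{w', x'} \<in> E n" "\<Psi> w' = (u @ [f]) @ [y, z, t]" "\<Psi> x' = (u @ [f]) @ [y', z', t']"
    "conn {2..<n} E w w'" "conn {2..<n} E x x'"
    by (rule transport_prefix[OF assms(1,3) x _ g(1) u(1,2)]) (use u(3) assms(4) in auto)
  have n3: "n = Suc (Suc (Suc (length u)))" using u(3) assms(4) by simp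
  then have n: "n - 1 = length u + 2" "2 < n" "1 < n - 1" "n - 1 < n" "n < Suc n" by auto
  have m: "dual_move (n - 1) (\<Psi> w') = u @ [f, z, y, t]"
    unfolding e(2) using dual_move_triple[OF n(1), of f y z "[t]"] f(2) by simp
  have V': "w' \<in> V" "x' \<in> V" using edge_in_V[OF e(1) assms(2)] by auto
  obtain p where p: "{w', p} \<in> E (n - 1)" "\<Psi> p = u @ [f, z, y, t]"
    using lift_move[OF V'(1) n(3,4)] m e(2) far(2) by auto
  have Vp: "p \<in> V" using edge_in_V[OF p(1) n(3)] by simp
  \<comment> \<open>As \<open>t\<close> lies between \<open>y\<close> and \<open>z\<close>, the
    vertex \<open>p\<close> also has an \<open>n\<close>-edge. Uniqueness makes it the edge from
    \<open>w'\<close> to \<open>x'\<close>, and \<open>p \<noteq> w'\<close> leaves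
    \<open>p = x'\<close>.\<close>
  have "asc (\<Psi> p) (n - 1) = (z < y)" using asc_pair[of "n - 1" "u @ [f]" z y "[t]"] p(2) n3 by simp
  moreover have "asc (\<Psi> p) n = (y < t)" using asc_pair[of n "u @ [f, z]" y t "[]"] p(2) n3 by simp
  ultimately obtain q where q: "{p, q} \<in> E n"
    using edge_iff[OF Vp assms(2)] assms(5) by (auto simp: between_def)
  have c: "conn {n - 1, n} E w' p" using p(1) by (auto intro: conn_edge)
  have "{p, q} = {w', x'}"
    by (rule deg_unique_edges(1)[OF deg n(2,5) p(1) e(1) Vp c q])
  moreover have "p \<noteq> w'" using edge_in_V(3)[OF p(1) n(3)] by auto
  ultimately have "p = x'" by (auto simp: doubleton_eq_iff)
  then have eq: "[y', z', t'] = [z, y, t]" using e(3) p(2) by simp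
  then show "\<Psi> x = a @ [z, y, t]" using x by simp
  \<comment> \<open>The \<open>n\<close>-edge is thus also an \<open>(n - 1)\<close>-edge;
    \<open>inj_top\<close> uses this to bypass it.\<close>
  have "conn {2..<n} E w' x'" using p(1) \<open>p = x'\<close> n by (auto intro!: conn_edge)
  then show "conn {2..<n} E w x" using e(4,5) conn_trans conn_sym by metis
qed

text \<open>Since \<open>y\<close> and \<open>z\<close> lie on the same side of \<open>c\<close>, an
  \<open>(n - 1)\<close>-edge could only lead to \<open>r y c z d\<close>. There the last three
  letters are monotone, so no \<open>n\<close>-edge is possible. This supplies the exclusions in
  \<open>deg_square\<close>.\<close>

lemma no_double_edge:
  assumes "{p, q} \<in> E n" "\<Psi> p = r @ [y, z, c, d]" "n = length r + 3" "between c y d" "between c z d"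
  shows "{p, q} \<notin> E (n - 1)"
proof
  assume a: "{p, q} \<in> E (n - 1)"
  have n: "n - 1 = length r + 2" "1 < n - 1" "n - 1 < n" "1 < n" using assms(3) by auto
  have V: "p \<in> V" "q \<in> V" using edge_in_V[OF assms(1) n(4)] by auto
  have q: "\<Psi> q = dual_move (n - 1) (\<Psi> p)" by (rule edge[OF n(2,3) a])
  have "dual_move (n - 1) (\<Psi> p) \<noteq> \<Psi> p" using edge_iff_move[OF V(1) n(2)] a n by auto
  then have "\<Psi> q = (r @ [y]) @ [c, z, d]"
    using q dual_move_triple[OF n(1), of y z c "[d]"] assms(2,4,5) by (auto simp: between_def split: if_splits)
  moreover have "{q, p} \<in> E n" using assms(1) by (simp add: insert_commute)
  ultimately have "(c < z) \<noteq> (z < d)" using sign_edge(1)[OF _ n(4)] assms(3) by fastforce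
  then show False using assms(5) by (auto simp: between_def)
qed

text \<open>Let \<open>n - 1\<close> run through the corners between \<open>n\<close> and \<open>n + 1\<close> by \<open>(n - 2)\<close>-edges: these
  commute with the \<open>n\<close>-edges, since the relevant component is never the five-vertex one.\<close>
lemma middle_corner_transfer:
  assumes "{w, x} \<in> E n" "\<Psi> w = a @ [e, c, d]" "\<Psi> x = a @ [e, c', d']" "n = length a + 2"
    and be: "between c e d" "between c' e d'"
    and g: "removable (shape (a @ [e])) g" "between c g d"
  shows "between c' g d'"
proof (cases "g = e")
  case True
  then show ?thesis using be by simp
next
  case False
  have n1: "1 < n"
  proof (rule ccontr)
    assume "\<not> 1 < n"
    then show False using assms(4) by simp
  qed
  have V: "w \<in> V" "x \<in> V" using edge_in_V[OF assms(1) n1] by auto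
  have st: "std_word a" "addable (shape a) e"
    using std[OF V(1)] assms(2) by (auto simp: std_word_append)
  have "removable (shape (a @ [e])) e" using st removable_add_cell by (simp add: shape_snoc)
  then have far: "e + 2 \<le> g \<or> g + 2 \<le> e" using removable_far g(1) False by metis
  then have "removable (shape a) g" using g(1) by (simp add: shape_snoc removable_add_cell_far)
  then obtain u where u: "std_word (u @ [g])" "shape (u @ [g]) = shape a" "length a = Suc (length u)"
    using std_word_last_removable st(1) by metis
  have far': "g + 2 \<le> e \<or> e + 2 \<le> g" using far by blast
  have add: "addable (shape u) g" "std_word u" using u(1) by (auto simp: std_word_snoc)
  have "addable (add_cell (shape u) g) e" using st(2) u(2) by (simp add: shape_snoc)
  then have "addable (shape u) e" using addable_add_cell_far[OF far'] by blast
  \<comment> \<open>With \<open>f\<close> in front, the \<open>(n - 2)\<close>-move exchanges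
    \<open>g\<close> and \<open>e\<close>, so that \<open>g\<close> becomes the content of
    \<open>n - 1\<close>.\<close>
  then obtain f where f: "removable (shape u) f" "between g f e"
    using addable_separated add(1) False by metis
  obtain b where b: "std_word (b @ [f])" "shape (b @ [f]) = shape u" "length u = Suc (length b)"
    using std_word_last_removable add(2) f(1) by metis
  have st': "std_word ((b @ [f]) @ [g])" "shape ((b @ [f]) @ [g]) = shape a"
    unfolding std_word_snoc[of "b @ [f]"] shape_snoc[of "b @ [f]"] b(2)
    using b(1) add(1) u(2) by (simp_all add: shape_snoc)
  obtain w1 x1 where e1: "{w1, x1} \<in> E n" "\<Psi> w1 = ((b @ [f]) @ [g]) @ [e, c, d]"
    "\<Psi> x1 = ((b @ [f]) @ [g]) @ [e, c', d']"
    by (rule transport_prefix[OF assms(1-3) _ st(1) st']) (use u(3) b(3) assms(4) in auto)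
  have n: "n = length b + 4" "n - 2 = length b + 2" "1 < n - 2" "n - 2 < n" "n - 2 \<le> n" "3 < n" "n < Suc n"
    using u(3) b(3) assms(4) by auto
  have V1: "w1 \<in> V" "x1 \<in> V" using edge_in_V[OF e1(1) n1] by auto
  have swap: "dual_move (n - 2) (b @ f # g # e # r) = b @ f # e # g # r" for r
    using dual_move_triple[OF n(2), of f g e r] f(2) by simp
  have "dual_move (n - 2) (\<Psi> w1) = b @ [f, e, g, c, d]" using swap[of "[c, d]"] e1(2) by simp
  then obtain w2 where w2: "{w1, w2} \<in> E (n - 2)" "\<Psi> w2 = (b @ [f, e]) @ [g, c, d]"
    using lift_move[OF V1(1) n(3,4)] e1(2) False by auto
  have V2: "w2 \<in> V" using edge_in_V[OF w2(1) n(3,5)] by simp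
  have asc: "asc (\<Psi> w2) (n - 1) = (g < c)" "asc (\<Psi> w2) n = (c < d)"
    using asc_pair[of "n - 1" "b @ [f, e]" g c "[d]"] asc_pair[of n "b @ [f, e, g]" c d "[]"] w2(2) n(1)
    by simp_all
  then obtain x2 where x2: "{w2, x2} \<in> E n"
    using edge_iff[OF V2 n1] g(2) by (auto simp: between_def)
  have "{w1, x1} \<notin> E (n - 1)"
    using no_double_edge[OF e1(1), of "b @ [f]" g e c d] e1(2) n(1) be(1) g(2) by simp
  moreover have "{w2, x2} \<notin> E (n - 1)"
    using no_double_edge[OF x2, of "b @ [f]" e g c d] w2(2) n(1) be(1) g(2) by simp
  ultimately have "{x1, x2} \<in> E (n - 2)"
    by (rule deg_square[OF deg n(6,7) w2(1) e1(1) x2])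
  then have "\<Psi> x2 = dual_move (n - 2) (\<Psi> x1)" by (rule edge[OF n(3,4)])
  then have psx2: "\<Psi> x2 = (b @ [f, e]) @ [g, c', d']" using swap[of "[c', d']"] e1(3) by simp
  have x2': "{x2, w2} \<in> E n" using x2 by (simp add: insert_commute)
  have ln: "n = length (b @ [f, e]) + 2" using n(1) by simp
  note sx = sign_edge[OF x2' n1 psx2 ln]
  have "s w2 (n - 1) \<noteq> s x2 (n - 1)" by (rule deg_sign_flip(1)[OF deg x2 n1 n(7)])
  moreover have "s w2 (n - 1) = (g < c)" by (rule sign_edge(5)[OF x2 n1 w2(2) ln])
  ultimately have opp: "(g < c) \<noteq> (g < c')" using sx(5) by simp
  show ?thesis
  proof (rule ccontr)
    assume "\<not> between c' g d'"
    \<comment> \<open>In this order \<open>edge_last_fixed\<close>, applied from \<open>x2\<close>,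
      would put \<open>c'\<close> at the place where \<open>w2\<close> has \<open>g\<close>.\<close>
    then have "between g d' c'" using sx(7) by blast
    from edge_last_fixed(1)[OF x2' n1 psx2 ln this] have "g = c'" using w2(2) by simp
    then show False using sx(2) by simp
  qed
qed

text \<open>If \<open>e \<noteq> e'\<close>, a corner \<open>f\<close> between them, put in place
  \<open>n - 2\<close>, makes the sign at \<open>n - 2\<close> change along the edge. Axiom 3 then
  gives both ends an \<open>(n - 1)\<close>-edge, and by uniqueness this edge joins
  \<open>w'\<close> to \<open>x'\<close>, so \<open>d = d'\<close>. But axiom 3 also puts
  \<open>d\<close> on the side of \<open>e\<close> and \<open>d'\<close> on the side of
  \<open>e'\<close>, as seen from \<open>f\<close>.\<close>

lemma edge_middle_eq:
  assumes "{w, x} \<in> E n" "1 < n" "\<Psi> w = a @ [e, c, d]" "\<Psi> x = a @ [e', c', d']" "n = length a + 2"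
    and be: "between c e d" "between c' e' d'"
  shows "e = e'"
proof (rule ccontr)
  assume ne: "e \<noteq> e'"
  have V: "w \<in> V" "x \<in> V" using edge_in_V[OF assms(1,2)] by auto
  have st: "std_word a" "addable (shape a) e" "addable (shape a) e'"
    using std[OF V(1)] std[OF V(2)] assms(3,4) by (auto simp: std_word_append)
  obtain f where f: "removable (shape a) f" "between e f e'" using addable_separated st(2,3) ne by metis
  obtain u where u: "std_word (u @ [f])" "shape (u @ [f]) = shape a" "length a = Suc (length u)"
    using std_word_last_removable st(1) f(1) by metis
  obtain w' x' where e: "{w', x'} \<in> E n" "\<Psi> w' = (u @ [f]) @ [e, c, d]" "\<Psi> x' = (u @ [f]) @ [e', c', d']"
    by (rule transport_prefix[OF assms(1,3,4) _ st(1) u(1,2)]) (use u(3) assms(5) in auto)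
  have n3: "n = Suc (Suc (Suc (length u)))" using u(3) assms(5) by simp
  then have n: "n - 1 = length u + 2" "2 < n" "1 < n - 1" "n - 1 < n" "n < Suc n" "3 \<le> n"
    "1 \<le> n - 2" "n - 2 \<le> n" "n - 1 \<le> n" "n - 1 - 1 = n - 2" by auto
  have e': "{x', w'} \<in> E n" using e(1) by (simp add: insert_commute)
  have V': "w' \<in> V" "x' \<in> V" using edge_in_V[OF e(1) assms(2)] by auto
  have ln: "n = length (u @ [f]) + 2" using n3 by simp
  note sw = sign_edge[OF e(1) assms(2) e(2) ln] and sx = sign_edge[OF e' assms(2) e(3) ln]
  have s2: "s w' (n - 2) = (f < e)" "s x' (n - 2) = (f < e')"
    using sign[OF V'(1) n(7,8)] sign[OF V'(2) n(7,8)] e(2,3)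
      asc_pair[of "n - 2" u f e "[c, d]"] asc_pair[of "n - 2" u f e' "[c', d']"] n3 by simp_all
  have ne2: "s w' (n - 2) \<noteq> s x' (n - 2)" using s2 f(2) by (auto simp: between_def)
  have "s w' (n - 2) \<noteq> s w' (n - 1)"
    by (rule deg_sign_left[OF deg e(1) n(6,5) ne2])
  then have ow: "(f < e) \<noteq> (e < c)" using s2(1) sw(5) by simp
  have "s x' (n - 2) \<noteq> s x' (n - 1)"
    by (rule deg_sign_left[OF deg e' n(6,5)]) (use ne2 in simp)
  then have ox: "(f < e') \<noteq> (e' < c')" using s2(2) sx(5) by simp
  have "asc (\<Psi> w') (n - 2) \<noteq> asc (\<Psi> w') (n - 1)"
    using ow s2(1) sw(5) sign[OF V'(1) n(7,8)] sign[OF V'(1) _ n(9)] n(3) by simp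
  then obtain p where p: "{w', p} \<in> E (n - 1)" using edge_iff[OF V'(1) n(3,9)] n(10) by auto
  have "asc (\<Psi> x') (n - 2) \<noteq> asc (\<Psi> x') (n - 1)"
    using ox s2(2) sx(5) sign[OF V'(2) n(7,8)] sign[OF V'(2) _ n(9)] n(3) by simp
  then obtain q where q: "{x', q} \<in> E (n - 1)" using edge_iff[OF V'(2) n(3,9)] n(10) by auto
  have c1: "conn {n - 1, n} E w' x'" using e(1) by (auto intro: conn_edge)
  have "{x', q} = {w', p}"
    by (rule deg_unique_edges(2)[OF deg n(2,5) p e(1) V'(2) c1 q])
  moreover have "w' \<noteq> x'" using edge_in_V(3)[OF e(1) assms(2)] by simp
  ultimately have "x' = p" by (auto simp: doubleton_eq_iff)
  then have "\<Psi> x' = dual_move (n - 1) (\<Psi> w')" using edge[OF n(3,4) p] by simp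
  then have "d' = d"
    using dual_move_triple[OF n(1), of f e c "[d]"] e(2,3) by (auto split: if_splits)
  then show False using be f(2) ow ox unfolding between_def by linarith
qed

text \<open>All of \<open>c\<close>, \<open>d\<close>, \<open>c'\<close>, \<open>d'\<close> are
  addable in the shape \<open>K\<close>, with \<open>c\<close> and \<open>c'\<close> on opposite
  sides of \<open>e\<close>. The two intervals contain the same removable corners, and different
  addable corners are separated by a removable one; so the endpoints on the same side of
  \<open>e\<close> coincide.\<close>

lemma edge_last_moved:
  assumes "{w, x} \<in> E n" "1 < n" "\<Psi> w = a @ [e, c, d]" "\<Psi> x = a @ [e', c', d']" "n = length a + 2"
    and be: "between c e d" "between c' e' d'"
  shows "\<Psi> x = a @ [e, d, c]"
proof -
  have V: "w \<in> V" "x \<in> V" using edge_in_V[OF assms(1,2)] by auto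
  have e: "e' = e" using edge_middle_eq[OF assms] by simp
  note x = assms(4)[unfolded e] and be = be[unfolded e]
  have r: "{x, w} \<in> E n" using assms(1) by (simp add: insert_commute)
  define K where "K = shape (a @ [e])"
  have far: "c + 2 \<le> d \<or> d + 2 \<le> c" "c' + 2 \<le> d' \<or> d' + 2 \<le> c'"
    using be by (auto simp: between_def)
  have g: "growth K [c, d]" "growth K [c', d']"
    using std[OF V(1)] std[OF V(2)] assms(3) x by (simp_all add: std_word_append K_def shape_snoc)
  then have ad: "addable K c" "addable K d" "addable K c'" "addable K d'"
    using addable_add_cell_far far by auto
  have "s w (n - 1) \<noteq> s x (n - 1)"
    by (rule deg_sign_flip(1)[OF deg assms(1,2)]) simp
  then have opp: "(e < c) \<noteq> (e < c')"
    using sign_edge(5)[OF assms(1,2,3,5)] sign_edge(5)[OF r assms(2) x assms(5)] by simp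
  have tr: "between c g d \<longleftrightarrow> between c' g d'" if "removable K g" for g
    using middle_corner_transfer[OF assms(1,3) x assms(5) be] middle_corner_transfer[OF r x assms(3,5) be(2,1)]
      that unfolding K_def by blast
  have "c = d'"
  proof (rule ccontr)
    assume "c \<noteq> d'"
    then obtain g where "removable K g" "between c g d'" using addable_separated ad(1,4) by metis
    then show False using tr[of g] be opp unfolding between_def by linarith
  qed
  moreover have "d = c'"
  proof (rule ccontr)
    assume "d \<noteq> c'"
    then obtain g where "removable K g" "between d g c'" using addable_separated ad(2,3) by metis
    then show False using tr[of g] be opp unfolding between_def by linarith
  qed
  ultimately show ?thesis using x by simp
qed

lemma edge_top:
  assumes "{w, x} \<in> E n" "1 < n"
  shows "\<Psi> x = dual_move n (\<Psi> w)"
proof -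
  obtain a y z t y' z' t' where d: "\<Psi> w = a @ [y, z, t]" "\<Psi> x = a @ [y', z', t']" "n = length a + 2"
    using edge_common_prefix[OF assms] by blast
  have r: "{x, w} \<in> E n" using assms(1) by (simp add: insert_commute)
  note sw = sign_edge[OF assms d(1,3)] and sx = sign_edge[OF r assms(2) d(2,3)]
  have m: "dual_move n (\<Psi> w) = a @ (if between y t z then [z, y, t] else [y, t, z])"
    using dual_move_triple[OF d(3), of y z t "[]"] sw(7) d(1) by (auto simp: between_def)
  consider "between y t z" | "between y' t' z'" | "between z y t" "between z' y' t'"
    using sw(7) sx(7) by blast
  then show ?thesis
  proof cases
    case 1
    then show ?thesis using edge_last_fixed(1)[OF assms d(1,3)] m by simp
  next
    case 2
    \<comment> \<open>The case is read from the other end of the edge, because the fixed last letter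
      is recognised there.\<close>
    then have "\<Psi> w = a @ [z', y', t']" using edge_last_fixed(1)[OF r assms(2) d(2,3)] by simp
    then have "y = z'" "z = y'" "t = t'" using d(1) by auto
    then show ?thesis using m d(2) 2 by (auto simp: between_def)
  next
    case 3
    then have "\<Psi> x = a @ [y, t, z]" using edge_last_moved[OF assms d] by simp
    moreover have "\<not> between y t z" using 3(1) by (auto simp: between_def)
    ultimately show ?thesis using m by simp
  qed
qed

section \<open>Injectivity on components that use the colour \<open>n\<close>\<close>

lemma conn_last_eq:
  assumes "x \<in> V" "conn {2..<n} E x y"
  shows "y \<in> V \<and> shape (\<Psi> y) = shape (\<Psi> x) \<and> last (\<Psi> y) = last (\<Psi> x)"
  using assms(2) unfolding conn_def
proof (induction rule: rtranclp_induct)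
  case base
  then show ?case using assms by simp
next
  case (step y z)
  from step(2) obtain i where "i \<in> {2..<n}" "{y, z} \<in> E i" by blast
  then have i: "1 < i" "i < n" "{y, z} \<in> E i" by auto
  have "z \<in> V" using edge_in_V(2)[OF i(3,1)] i(2) by simp
  moreover have y: "y \<in> V" using step by simp
  obtain a k where a: "\<Psi> y = a @ [k]" using len[OF y] by (cases "\<Psi> y" rule: rev_cases) auto
  have "\<Psi> z = dual_move i a @ [k]"
    using edge[OF i] a dual_move_append[of i a] len[OF y] i(2) by simp
  moreover have "shape (\<Psi> z) = shape (\<Psi> y)"
    using edge[OF i] std_word_dual_move(2)[OF std[OF y] i(1)] len[OF y] i(2) by simp
  moreover have "shape (\<Psi> y) = shape (\<Psi> x)" "last (\<Psi> y) = last (\<Psi> x)" using step by auto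
  ultimately show ?case using a by auto
qed

text \<open>Axiom 6 leaves at most one \<open>n\<close>-edge on a path from \<open>x\<close> to
  \<open>y\<close>. Lower colours keep the last letter, so equal words force this edge to keep it as
  well, and such an edge can be replaced by a path of lower colours.\<close>

lemma inj_top:
  assumes "x \<in> V" "y \<in> V" "conn {2..<Suc n} E x y" "\<Psi> x = \<Psi> y"
  shows "x = y"
proof (rule inj[OF assms(1,2) _ assms(4)], cases "1 < n")
  case False
  then have "{2..<Suc n} = {2..<n}" by auto
  then show "conn {2..<n} E x y" using assms(3) by simp
next
  case True
  have "conn {2..n} E x y" using assms(3) by (simp add: atLeastLessThanSuc_atLeastAtMost)
  from deg_one_edge[OF deg this True _ assms(1,2)]
  consider "conn {2..<n} E x y" | a b where "{a, b} \<in> E n" "conn {2..<n} E x a" "conn {2..<n} E b y"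
    by auto
  then show "conn {2..<n} E x y"
  proof cases
    case 2
    have V: "a \<in> V" "b \<in> V" using edge_in_V[OF 2(1) True] by auto
    have la: "last (\<Psi> a) = last (\<Psi> b)"
      using conn_last_eq[OF assms(1) 2(2)] conn_last_eq[OF V(2) 2(3)] assms(4) by simp
    obtain r p z t p' z' t' where d: "\<Psi> a = r @ [p, z, t]" "\<Psi> b = r @ [p', z', t']" "n = length r + 2"
      using edge_common_prefix[OF 2(1) True] by blast
    have "between p t z"
    proof (rule ccontr)
      assume nb: "\<not> between p t z"
      then have "between z p t" using sign_edge(7)[OF 2(1) True d(1,3)] by blast
      then have "\<Psi> b = r @ [p, t, z]"
        using edge_top[OF 2(1) True] dual_move_triple[OF d(3), of p z t "[]"] d(1) by simp
      then show False using la d(1) sign_edge(3)[OF 2(1) True d(1,3)] by simp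
    qed
    then have "conn {2..<n} E a b" using edge_last_fixed(2)[OF 2(1) True d(1,3)] by blast
    then show ?thesis using 2 conn_trans by metis
  qed
qed

end

section \<open>Labelling by content words\<close>

text \<open>Injectivity is asked for within components only, since different components may be
  copies of the same graph.\<close>

definition labelled :: "nat \<Rightarrow> 'a set \<Rightarrow> ('a \<Rightarrow> nat \<Rightarrow> bool) \<Rightarrow> (nat \<Rightarrow> 'a set set) \<Rightarrow>
    ('a \<Rightarrow> int list) \<Rightarrow> bool" where
  "labelled n V s E \<Phi> \<longleftrightarrow>
     (\<forall>v\<in>V. std_word (\<Phi> v) \<and> length (\<Phi> v) = n \<and> (\<forall>k. 1 \<le> k \<and> k < n \<longrightarrow> s v k = asc (\<Phi> v) k)) \<and>
     (\<forall>i x y. 1 < i \<and> i < n \<and> {x, y} \<in> E i \<longrightarrow> \<Phi> y = dual_move i (\<Phi> x)) \<and>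
     (\<forall>x\<in>V. \<forall>y\<in>V. conn {2..<n} E x y \<and> \<Phi> x = \<Phi> y \<longrightarrow> x = y)"

lemma labelledD:
  assumes "labelled n V s E \<Phi>"
  shows "v \<in> V \<Longrightarrow> std_word (\<Phi> v)" "v \<in> V \<Longrightarrow> length (\<Phi> v) = n"
    "v \<in> V \<Longrightarrow> 1 \<le> k \<Longrightarrow> k < n \<Longrightarrow> s v k = asc (\<Phi> v) k"
    "1 < i \<Longrightarrow> i < n \<Longrightarrow> {x, y} \<in> E i \<Longrightarrow> \<Phi> y = dual_move i (\<Phi> x)"
    "x \<in> V \<Longrightarrow> y \<in> V \<Longrightarrow> conn {2..<n} E x y \<Longrightarrow> \<Phi> x = \<Phi> y \<Longrightarrow> x = y"
  using assms by (simp_all add: labelled_def)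

lemma labelled_conn_shape:
  assumes "deg n n V s E" "labelled n V s E \<Phi>" "x \<in> V" "conn {2..<n} E x y"
  shows "y \<in> V \<and> shape (\<Phi> y) = shape (\<Phi> x)"
  using assms(4) unfolding conn_def
proof (induction rule: rtranclp_induct)
  case base
  then show ?case using assms by simp
next
  case (step y z)
  from step(2) obtain i where "i \<in> {2..<n}" "{y, z} \<in> E i" by blast
  then have i: "{y, z} \<in> E i" "1 < i" "i < n" by auto
  have "z \<in> V" using deg_edge(2)[OF assms(1) i] .
  moreover have "\<Phi> z = dual_move i (\<Phi> y)" using labelledD(4)[OF assms(2) i(2,3,1)] .
  moreover have "std_word (\<Phi> y)" "length (\<Phi> y) = n" using labelledD(1,2)[OF assms(2)] step by auto
  ultimately show ?case using std_word_dual_move(2)[of "\<Phi> y" i] i step by simp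
qed

text \<open>The bound \<open>m\<close> is separate from \<open>n\<close> because
  \<open>top_sign_corner\<close> needs paths of colours below \<open>n - 1\<close>, along which the
  sign at \<open>n\<close> is constant.\<close>

lemma labelled_lift:
  assumes "deg n n V s E" "labelled n V s E \<Phi>" "v \<in> V" "moves m ms" "m \<le> n"
  obtains y where "y \<in> V" "conn {2..<m} E v y" "\<Phi> y = dual_moves ms (\<Phi> v)"
  using assms(3,4)
proof (induction ms arbitrary: v thesis)
  case Nil
  then show ?case by auto
next
  case (Cons i ms)
  have i: "1 < i" "i < n" "i < m" "moves m ms" using Cons.prems assms(5) by (auto simp: moves_def)
  note v = Cons.prems(2)
  obtain u where u: "u \<in> V" "conn {2..<m} E v u" "\<Phi> u = dual_move i (\<Phi> v)"
  proof (cases "dual_move i (\<Phi> v) = \<Phi> v")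
    case True
    then show ?thesis using that[of v] v by simp
  next
    case False
    have "asc (\<Phi> v) (i - 1) \<noteq> asc (\<Phi> v) i"
      using std_word_dual_move(4)[OF labelledD(1)[OF assms(2) v] i(1)] labelledD(2)[OF assms(2) v]
        i(2) False by simp
    moreover have "1 \<le> i - 1" "i - 1 < n" "1 \<le> i" using i by auto
    ultimately have "s v (i - 1) \<noteq> s v i" using labelledD(3)[OF assms(2) v] i(2) by simp
    then obtain u where u: "{v, u} \<in> E i"
      using deg_edge_iff[OF assms(1) v i(1,2)] by blast
    show ?thesis
    proof (rule that)
      show "u \<in> V" using deg_edge(2)[OF assms(1) u i(1,2)] .
      show "conn {2..<m} E v u" using u i by (auto intro: conn_edge)
      show "\<Phi> u = dual_move i (\<Phi> v)" using labelledD(4)[OF assms(2) i(1,2) u] .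
    qed
  qed
  obtain y where y: "y \<in> V" "conn {2..<m} E u y" "\<Phi> y = dual_moves ms (\<Phi> u)"
    using Cons.IH[OF _ u(1) i(4)] by blast
  have "conn {2..<m} E v y" using conn_trans u(2) y(2) by metis
  then show ?case using Cons.prems(1)[OF y(1)] y(3) u(3) by simp
qed

lemma labelled_surj:
  assumes "deg n n V s E" "labelled n V s E \<Phi>" "v \<in> V"
    and "std_word w" "length w = n" "shape w = shape (\<Phi> v)"
  obtains y where "y \<in> V" "conn {2..<n} E v y" "\<Phi> y = w"
proof -
  have "std_word (\<Phi> v)" "length (\<Phi> v) = n" using labelledD(1,2)[OF assms(2,3)] by auto
  then obtain ms where "moves n ms" "dual_moves ms (\<Phi> v) = w"
    using std_word_connected[of "\<Phi> v" w] assms(4-6) by metis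
  then show ?thesis using labelled_lift[OF assms(1-3) _ order_refl] that by metis
qed

text \<open>The sign of \<open>n\<close> only depends on the last letter of the word and, by the third axiom,
  is monotone in it; hence it is the comparison with a unique addable corner.\<close>
lemma top_sign_corner:
  assumes "deg (Suc n) (Suc n) V s E" "labelled n V s E \<Phi>" "v \<in> V" "1 \<le> n"
  obtains k where "addable (shape (\<Phi> v)) k"
    "\<And>x. conn {2..<n} E v x \<Longrightarrow> s x n = (last (\<Phi> x) < k)"
proof -
  note deg = deg_restrict[OF assms(1)]
  note lab = labelledD(1,2)[OF assms(2)] and labE = labelledD(4)[OF assms(2)]
  define C where "C = {x. conn {2..<n} E v x}"
  have C: "x \<in> V" "shape (\<Phi> x) = shape (\<Phi> v)" if "x \<in> C" for x
    using labelled_conn_shape[OF deg assms(2,3), of x] that unfolding C_def by blast+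
  have keep: "s x n = s y n" if x: "x \<in> V" and c: "conn {2..<n - 1} E x y" for x y
    using c unfolding conn_def
  proof (induction rule: rtranclp_induct)
    case (step y z)
    from step(2) obtain i where i: "i \<in> {2..<n - 1}" "{y, z} \<in> E i" by blast
    then have i': "1 < i" "i < Suc n" "i + 1 < n" by auto
    have "s y n = s z n"
      by (rule deg_sign_keep[OF assms(1) i(2) i'(1,2)]) (use i'(3) assms(4) in auto)
    then show ?case using step by simp
  qed simp
  \<comment> \<open>If the last letters agree, the prefixes have the same shape and are connected by
    moves of colour below \<open>n - 1\<close>. The lifted path from \<open>x\<close> ends at
    \<open>y\<close> by injectivity.\<close>
  have same: "s x n = s y n" if xy: "x \<in> C" "y \<in> C" and l: "last (\<Phi> x) = last (\<Phi> y)" for x y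
  proof -
    obtain a c where a: "\<Phi> x = a @ [c]"
      using lab(2)[OF C(1)[OF xy(1)]] assms(4) by (cases "\<Phi> x" rule: rev_cases) auto
    obtain b d where b: "\<Phi> y = b @ [d]"
      using lab(2)[OF C(1)[OF xy(2)]] assms(4) by (cases "\<Phi> y" rule: rev_cases) auto
    have dc: "d = c" using a b l by simp
    have st: "std_word a" "std_word b" "addable (shape a) c" "addable (shape b) c"
      "length a = n - 1" "length b = n - 1"
      using lab[OF C(1)[OF xy(1)]] lab[OF C(1)[OF xy(2)]] a b dc by (auto simp: std_word_snoc)
    have "add_cell (shape a) c = add_cell (shape b) c"
      using C(2)[OF xy(1)] C(2)[OF xy(2)] a b dc by (simp add: shape_snoc)
    then have "shape a = shape b" using add_cell_inj st by blast
    then obtain ms where ms: "moves (n - 1) ms" "dual_moves ms a = b"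
      using std_word_connected[of a b] st by metis
    obtain z where z: "z \<in> V" "conn {2..<n - 1} E x z" "\<Phi> z = dual_moves ms (\<Phi> x)"
      by (rule labelled_lift[OF deg assms(2) C(1)[OF xy(1)] ms(1)]) auto
    have "\<Phi> z = \<Phi> y" using z(3) dual_moves_append[OF ms(1), of a "[c]"] ms(2) a b dc st(5) by simp
    moreover have "conn {2..<n} E z y"
    proof -
      have "conn {2..<n} E x z" by (rule conn_mono[OF z(2)]) auto
      moreover have "conn {2..<n} E v x" "conn {2..<n} E v y" using xy by (simp_all add: C_def)
      ultimately show ?thesis using conn_trans conn_sym by metis
    qed
    ultimately have "z = y" using labelledD(5)[OF assms(2) z(1) C(1)[OF xy(2)]] by blast
    then show ?thesis using keep[OF C(1)[OF xy(1)] z(2)] by simp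
  qed
  define g where "g c \<longleftrightarrow> (\<exists>x\<in>C. last (\<Phi> x) = c \<and> s x n)" for c
  have g: "s x n = g (last (\<Phi> x))" if "x \<in> C" for x
    unfolding g_def using same that by blast
  \<comment> \<open>Otherwise take \<open>x\<close> with word ending in \<open>f, c, d\<close>,
    where \<open>f\<close> lies between \<open>c\<close> and \<open>d\<close>; its
    \<open>(n - 1)\<close>-edge leads to a word ending in \<open>f, d, c\<close>. The sign at
    \<open>n\<close> changes, so by axiom 3 the signs of \<open>x\<close> at \<open>n - 1\<close>
    and \<open>n\<close> differ, yet both are positive.\<close>
  have mono: "g c" if cd: "removable (shape (\<Phi> v)) c" "removable (shape (\<Phi> v)) d" "c < d" and gd: "g d" for c d
  proof (rule ccontr)
    assume gc: "\<not> g c"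
    have far: "c + 2 \<le> d \<or> d + 2 \<le> c" using removable_far[OF cd(1,2)] cd(3) by auto
    obtain u where u: "std_word (u @ [d])" "shape (u @ [d]) = shape (\<Phi> v)" "n = Suc (length u)"
      by (rule std_word_last_removable[OF lab(1)[OF assms(3)] cd(2)]) (use lab(2)[OF assms(3)] in simp)
    have "removable (shape u) c" using cd(1) u(2) far by (metis shape_snoc removable_add_cell_far)
    moreover have us: "std_word u" using u(1) by (simp add: std_word_snoc)
    ultimately obtain z where z: "std_word (z @ [c])" "shape (z @ [c]) = shape u" "length u = Suc (length z)"
      using std_word_last_removable by metis
    have zs: "std_word z" "addable (shape z) c" using z by (auto simp: std_word_snoc)
    have "addable (add_cell (shape z) c) d" using u(1) z(2) by (simp add: std_word_snoc shape_snoc)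
    then have zd: "addable (shape z) d" using addable_add_cell_far far by blast
    obtain f where f: "removable (shape z) f" "between c f d"
      by (rule addable_separated[OF zs(2) zd]) (use cd(3) in auto)
    obtain r where r: "std_word (r @ [f])" "shape (r @ [f]) = shape z" "length z = Suc (length r)"
      using std_word_last_removable zs(1) f(1) by metis
    have "std_word (((r @ [f]) @ [c]) @ [d])" "shape (((r @ [f]) @ [c]) @ [d]) = shape (\<Phi> v)"
      unfolding std_word_snoc[of "(r @ [f]) @ [c]"] std_word_snoc[of "r @ [f]"]
        shape_snoc[of "(r @ [f]) @ [c]"] shape_snoc[of "r @ [f]"] r(2)
      using r(1) zs(2) z(2) u by (simp_all add: shape_snoc std_word_snoc)
    moreover have "length (((r @ [f]) @ [c]) @ [d]) = n" using u(3) z(3) r(3) by simp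
    ultimately obtain x where x: "x \<in> V" "conn {2..<n} E v x" "\<Phi> x = ((r @ [f]) @ [c]) @ [d]"
      using labelled_surj[OF deg assms(2,3)] by blast
    have n: "n - 1 = length r + 2" "1 < n - 1" "n - 1 < n" "n - 1 < Suc n" "n - 1 + 1 < Suc n" "n - 1 + 1 = n"
      using u(3) z(3) r(3) by auto
    have m: "dual_move (n - 1) (\<Phi> x) = r @ [f, d, c]"
      unfolding x(3) using dual_move_triple[OF n(1), of f c d "[]"] f(2) by simp
    have "asc (\<Phi> x) (n - 1 - 1) = (f < c)" "asc (\<Phi> x) (n - 1) = (c < d)"
      unfolding x(3) using asc_pair[of "n - 1 - 1" r f c "[d]"] asc_pair[of "n - 1" "r @ [f]" c d "[]"] n
      by simp_all
    moreover have "s x (n - 1) = asc (\<Phi> x) (n - 1)" "s x (n - 1 - 1) = asc (\<Phi> x) (n - 1 - 1)"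
      using labelledD(3)[OF assms(2) x(1)] n by auto
    ultimately have sx: "s x (n - 1 - 1) \<noteq> s x (n - 1)" "s x (n - 1)"
      using f(2) cd(3) by (auto simp: between_def)
    then obtain y where y: "{x, y} \<in> E (n - 1)"
      using deg_edge_iff[OF deg x(1) n(2,3)] by auto
    have py: "\<Phi> y = r @ [f, d, c]" using labE[OF n(2,3) y] m by simp
    have "conn {2..<n} E x y" using y n by (auto intro: conn_edge)
    then have yC: "y \<in> C" using conn_trans[OF x(2)] by (simp add: C_def)
    have "s x n" using g[of x] x(2,3) gd by (simp add: C_def)
    moreover have "\<not> s y n" using g[OF yC] gc py by simp
    ultimately have "s x (n - 1 + 1) \<noteq> s x (n - 1)"
      using deg_sign_right[OF assms(1) y n(2,4,5)] n(6) by simp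
    then show False using sx(2) \<open>s x n\<close> n(6) by simp
  qed
  obtain k where k: "addable (shape (\<Phi> v)) k" "\<And>f. removable (shape (\<Phi> v)) f \<Longrightarrow> g f = (f < k)"
    using ex_addable_cut[OF lab(1)[OF assms(3)], of g] mono by metis
  show ?thesis
  proof (rule that[OF k(1)])
    fix x assume "conn {2..<n} E v x"
    then have x: "x \<in> C" by (simp add: C_def)
    obtain a c where a: "\<Phi> x = a @ [c]"
      using lab(2)[OF C(1)[OF x]] assms(4) by (cases "\<Phi> x" rule: rev_cases) auto
    have "removable (shape (\<Phi> x)) c"
      using lab(1)[OF C(1)[OF x]] removable_add_cell a by (simp add: std_word_snoc shape_snoc)
    then show "s x n = (last (\<Phi> x) < k)" using g[OF x] k(2)[of c] C(2)[OF x] a by simp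
  qed
qed

lemma conn_empty: "conn {} E x y \<longleftrightarrow> x = y"
proof
  assume "conn {} E x y"
  then show "x = y" unfolding conn_def by (induction rule: rtranclp_induct) auto
qed simp

lemma deg_labelled:
  fixes V :: "'a set"
  assumes "deg n n V s E"
  shows "\<exists>\<Phi>. labelled n V s E \<Phi>"
  using assms
proof (induction n)
  case 0
  have "labelled 0 V s E (\<lambda>_. [])" by (simp add: labelled_def conn_empty)
  then show ?case by blast
next
  case (Suc n)
  show ?case
  proof (cases "n = 0")
    case True
    \<comment> \<open>Type (1, 1) is treated apart, as the corner for a new entry is found by
      comparison with a last letter. The only standard word of length one is
      \<open>[0]\<close>.\<close>
    have "{2..<Suc n} = {}" using True by auto
    then have "labelled (Suc n) V s E (\<lambda>_. [0])"
      using True by (simp add: labelled_def conn_empty std_word_def addable_def empty_shape_def)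
    then show ?thesis by blast
  next
    case False
    then have n: "1 \<le> n" by simp
    note deg = deg_restrict[OF Suc.prems]
    obtain \<Phi> where \<Phi>: "labelled n V s E \<Phi>" using Suc.IH[OF deg] by blast
    define P where "P v k \<longleftrightarrow> addable (shape (\<Phi> v)) k \<and>
      (\<forall>x. conn {2..<n} E v x \<longrightarrow> s x n = (last (\<Phi> x) < k))" for v k
    have ex: "\<exists>k. P v k" if "v \<in> V" for v
      using top_sign_corner[OF Suc.prems \<Phi> that n] unfolding P_def by metis
    \<comment> \<open>A removable corner between two candidates is the last letter of some word in
      the component, where they predict different signs. Uniqueness makes the new letter constant on
      lower components.\<close>
    have uniq: "k = k'" if v: "v \<in> V" and k: "P v k" "P v k'" for v k k'
    proof (rule ccontr)
      assume ne: "k \<noteq> k'"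
      have ad: "addable (shape (\<Phi> v)) k" "addable (shape (\<Phi> v)) k'" using k by (auto simp: P_def)
      obtain f where f: "removable (shape (\<Phi> v)) f" "between k f k'"
        by (rule addable_separated[OF ad ne])
      obtain u where u: "std_word (u @ [f])" "shape (u @ [f]) = shape (\<Phi> v)"
        "length (\<Phi> v) = Suc (length u)"
        by (rule std_word_last_removable[OF labelledD(1)[OF \<Phi> v] f(1)])
      have "length (u @ [f]) = n" using u(3) labelledD(2)[OF \<Phi> v] by simp
      then obtain x where x: "conn {2..<n} E v x" "\<Phi> x = u @ [f]"
        using labelled_surj[OF deg \<Phi> v u(1) _ u(2)] by metis
      then have "(f < k) = (f < k')" using k unfolding P_def by (metis last_snoc)
      then show False using f(2) by (auto simp: between_def)
    qed
    define k where "k v = (SOME k. P v k)" for v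
    have k: "P v (k v)" if "v \<in> V" for v using ex[OF that] unfolding k_def by (rule someI_ex)
    have kk: "k y = k x" if x: "x \<in> V" and c: "conn {2..<n} E x y" for x y
    proof -
      have y: "y \<in> V" "shape (\<Phi> y) = shape (\<Phi> x)" using labelled_conn_shape[OF deg \<Phi> x c] by auto
      have "P y (k x)" using k[OF x] y(2) conn_trans[OF c] by (simp add: P_def)
      then show ?thesis using uniq[OF y(1) k[OF y(1)]] by simp
    qed
    define \<Psi> where "\<Psi> v = \<Phi> v @ [k v]" for v
    interpret word_labelling n V s E \<Psi>
    proof
      show "deg (Suc n) (Suc n) V s E" by (rule Suc.prems)
    next
      fix v assume v: "v \<in> V"
      show "std_word (\<Psi> v)"
        using k[OF v] labelledD(1)[OF \<Phi> v] by (simp add: \<Psi>_def std_word_snoc P_def)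
      show "length (\<Psi> v) = Suc n" using labelledD(2)[OF \<Phi> v] by (simp add: \<Psi>_def)
    next
      fix v m assume v: "v \<in> V" and m: "1 \<le> m" "m \<le> n"
      show "s v m = asc (\<Psi> v) m"
      proof (cases "m = n")
        case True
        obtain a c where a: "\<Phi> v = a @ [c]"
          using labelledD(2)[OF \<Phi> v] n by (cases "\<Phi> v" rule: rev_cases) auto
        have "n = length a + 1" using labelledD(2)[OF \<Phi> v] a by simp
        then have "asc (\<Psi> v) n = (c < k v)"
          using asc_pair[of n a c "k v" "[]"] a by (simp add: \<Psi>_def)
        then show ?thesis using k[OF v] a True by (simp add: P_def)
      next
        case False
        then show ?thesis using labelledD(2)[OF \<Phi> v] labelledD(3)[OF \<Phi> v m(1)] m
          by (simp add: \<Psi>_def asc_append)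
      qed
    next
      fix i x y assume i: "1 < i" "i < n" "{x, y} \<in> E i"
      have x: "x \<in> V" using deg_edge(1)[OF deg i(3,1,2)] .
      have "conn {2..<n} E x y" using i by (auto intro: conn_edge)
      then have "k y = k x" by (rule kk[OF x])
      moreover have "\<Phi> y = dual_move i (\<Phi> x)" by (rule labelledD(4)[OF \<Phi> i])
      ultimately show "\<Psi> y = dual_move i (\<Psi> x)"
        using dual_move_append labelledD(2)[OF \<Phi> x] i(2) by (simp add: \<Psi>_def)
    next
      fix x y assume xy: "x \<in> V" "y \<in> V" "conn {2..<n} E x y" "\<Psi> x = \<Psi> y"
      then show "x = y" using labelledD(5)[OF \<Phi> xy(1-3)] by (simp add: \<Psi>_def)
    qed
    have "labelled (Suc n) V s E \<Psi>"
      unfolding labelled_def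
    proof (intro conjI ballI allI impI; (elim conjE)?)
      fix i x y assume i: "1 < i" "i < Suc n" "{x, y} \<in> E i"
      show "\<Psi> y = dual_move i (\<Psi> x)"
      proof (cases "i = n")
        case True
        then show ?thesis using edge_top i by simp
      next
        case False
        then show ?thesis using edge[OF i(1) _ i(3)] i(2) by simp
      qed
    next
      fix x y assume "x \<in> V" "y \<in> V" "conn {2..<Suc n} E x y" "\<Psi> x = \<Psi> y"
      then show "x = y" by (rule inj_top)
    qed (use std len sign in auto)
    then show ?thesis by blast
  qed
qed

section \<open>Tableaux and their content words\<close>

text \<open>The row lengths shifted to a strictly decreasing sequence (beta numbers). Rows are
  numbered from 0 here, which absorbs the \<open>+ 1\<close> of
  \<open>\<lambda>\<^sub>j - j + 1\<close>.\<close>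

definition edge_seq :: "(nat \<Rightarrow> nat) \<Rightarrow> int \<Rightarrow> bool" where
  "edge_seq f k \<longleftrightarrow> (\<exists>j. k = int (f j) - int j)"

lemma edge_seq_zero: "edge_seq (\<lambda>_. 0) = empty_shape"
proof
  fix k :: int
  show "edge_seq (\<lambda>_. 0) k = empty_shape k"
    unfolding edge_seq_def empty_shape_def by (auto intro: exI[of _ "nat (- k)"])
qed

lemma edge_seq_strict:
  assumes "antimono f" "i < j"
  shows "int (f j) - int j < int (f i) - int i"
proof -
  have "f j \<le> f i" using assms by (auto simp: antimono_def)
  then show ?thesis using assms(2) by linarith
qed

lemma edge_seq_index_inj:
  assumes "antimono f" "int (f j) - int j = int (f i) - int i"
  shows "i = j"
  using edge_seq_strict[OF assms(1), of i j] edge_seq_strict[OF assms(1), of j i] assms(2)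
  by (metis less_irrefl linorder_neqE_nat)

text \<open>A strictly decreasing sequence is recovered from the set of its values, largest value
  first.\<close>

lemma edge_seq_inj:
  assumes "antimono f" "antimono g" "edge_seq f = edge_seq g"
  shows "f = g"
proof
  fix j
  show "f j = g j"
  proof (induction j rule: less_induct)
    case (less j)
    have le: "int (f j) \<le> int (g j)"
      if fg: "antimono f" "antimono g" "edge_seq f = edge_seq g" "\<And>i. i < j \<Longrightarrow> f i = g i" for f g
    proof -
      have "edge_seq g (int (f j) - int j)" unfolding fg(3)[symmetric] by (auto simp: edge_seq_def)
      then obtain m where m: "int (f j) - int j = int (g m) - int m" by (auto simp: edge_seq_def)
      have "\<not> m < j"
      proof
        assume "m < j"
        then have "int (f j) - int j = int (f m) - int m" using m fg(4) by simp
        then show False using edge_seq_index_inj[OF fg(1)] \<open>m < j\<close> by blast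
      qed
      then show ?thesis using m edge_seq_strict[OF fg(2), of j m] by (cases "m = j") auto
    qed
    have "f i = g i" "g i = f i" if "i < j" for i using less that by auto
    then show ?case using le[of f g] le[of g f] assms by simp
  qed
qed

definition grow_row :: "(nat \<Rightarrow> nat) \<Rightarrow> nat \<Rightarrow> (nat \<Rightarrow> nat)" where
  "grow_row f j = f(j := Suc (f j))"

lemma antimono_grow_row:
  assumes "antimono f" "j = 0 \<or> f j < f (j - 1)"
  shows "antimono (grow_row f j)"
proof (rule antimonoI)
  fix x y :: nat assume xy: "x \<le> y"
  have le: "f y \<le> f x" using assms(1) xy by (simp add: antimono_def)
  have "Suc (f j) \<le> f x" if "x < j"
  proof -
    have "f (j - 1) \<le> f x" using assms(1) that by (simp add: antimono_def)
    then show ?thesis using assms(2) that by auto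
  qed
  then show "grow_row f j y \<le> grow_row f j x" using le xy by (auto simp: grow_row_def)
qed

lemma addable_edge_seq:
  assumes "antimono f"
  shows "addable (edge_seq f) k \<longleftrightarrow> (\<exists>j. k = int (f j) - int j \<and> (j = 0 \<or> f j < f (j - 1)))"
proof
  assume "addable (edge_seq f) k"
  then obtain j where j: "k = int (f j) - int j" "\<not> edge_seq f (k + 1)"
    by (auto simp: addable_def edge_seq_def)
  have "f j < f (j - 1)" if "j \<noteq> 0"
  proof (rule ccontr)
    assume "\<not> f j < f (j - 1)"
    moreover have "f j \<le> f (j - 1)" using assms by (auto simp: antimono_def)
    ultimately have "k + 1 = int (f (j - 1)) - int (j - 1)" using that j(1) by auto
    then show False using j(2) by (auto simp: edge_seq_def)
  qed
  then show "\<exists>j. k = int (f j) - int j \<and> (j = 0 \<or> f j < f (j - 1))"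
    using j(1) by (intro exI[of _ j]) auto
next
  assume "\<exists>j. k = int (f j) - int j \<and> (j = 0 \<or> f j < f (j - 1))"
  then obtain j where j: "k = int (f j) - int j" "j = 0 \<or> f j < f (j - 1)" by blast
  have "\<not> edge_seq f (k + 1)"
  proof
    assume "edge_seq f (k + 1)"
    then obtain i where i: "k + 1 = int (f i) - int i" unfolding edge_seq_def by blast
    have "\<not> j < i" using edge_seq_strict[OF assms, of j i] i j(1) by linarith
    moreover have "i \<noteq> j" using i j(1) by auto
    ultimately have "i < j" by simp
    then have "f j < f (j - 1)" "i \<le> j - 1" using j(2) by auto
    moreover have "f (j - 1) \<le> f i" using assms \<open>i \<le> j - 1\<close> by (simp add: antimono_def)
    ultimately show False using i j(1) \<open>i < j\<close> by linarith
  qed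
  moreover have "edge_seq f k" using j(1) by (auto simp: edge_seq_def)
  ultimately show "addable (edge_seq f) k" by (simp add: addable_def)
qed

lemma add_cell_edge_seq:
  assumes "antimono f" "k = int (f j) - int j"
  shows "add_cell (edge_seq f) k = edge_seq (grow_row f j)"
proof
  fix l
  have 1: "l \<noteq> k + 1 \<Longrightarrow> edge_seq (grow_row f j) l \<longleftrightarrow> (\<exists>i. i \<noteq> j \<and> l = int (f i) - int i)"
    using assms(2) unfolding edge_seq_def grow_row_def
    by (metis add.commute add_diff_eq diff_diff_eq2 fun_upd_apply of_nat_Suc)
  have 2: "edge_seq (grow_row f j) (k + 1)"
    unfolding edge_seq_def grow_row_def using assms(2) by (intro exI[of _ j]) simp
  have 3: "(\<exists>i. i \<noteq> j \<and> l = int (f i) - int i) \<longleftrightarrow> edge_seq f l \<and> l \<noteq> k"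
    using assms(2) edge_seq_index_inj[OF assms(1)] unfolding edge_seq_def by metis
  show "add_cell (edge_seq f) k l = edge_seq (grow_row f j) l"
    using 1 2 3 by (auto simp: add_cell_def)
qed

section \<open>Tableaux on the diagram of a row function\<close>

definition diagram :: "(nat \<Rightarrow> nat) \<Rightarrow> (nat \<times> nat) set" where
  "diagram f = {(i, j). 1 \<le> i \<and> 1 \<le> j \<and> i \<le> f (j - 1)}"

text \<open>A row function on all naturals, instead of a list, makes adding or removing a cell a
  single update even when a row appears or vanishes.\<close>

definition tableau :: "(nat \<Rightarrow> nat) \<Rightarrow> nat \<Rightarrow> (nat \<times> nat \<Rightarrow> nat) \<Rightarrow> bool" where
  "tableau f n T \<longleftrightarrow> bij_betw T (diagram f) {1..n} \<and> (\<forall>c. c \<notin> diagram f \<longrightarrow> T c = 0) \<and>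
     (\<forall>i j. (i, j) \<in> diagram f \<and> (Suc i, j) \<in> diagram f \<longrightarrow> T (i, j) < T (Suc i, j)) \<and>
     (\<forall>i j. (i, j) \<in> diagram f \<and> (i, Suc j) \<in> diagram f \<longrightarrow> T (i, j) < T (i, Suc j))"

lemma diagram_grow_row:
  "diagram (grow_row f j) = insert (Suc (f j), Suc j) (diagram f)" "(Suc (f j), Suc j) \<notin> diagram f"
proof -
  have "(i, l) \<in> diagram (grow_row f j) \<longleftrightarrow> (i, l) \<in> insert (Suc (f j), Suc j) (diagram f)" for i l
    by (cases l) (auto simp: diagram_def grow_row_def le_Suc_eq)
  then show "diagram (grow_row f j) = insert (Suc (f j), Suc j) (diagram f)" by auto
qed (simp add: diagram_def)

lemma tableauD:
  assumes "tableau f n T"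
  shows "bij_betw T (diagram f) {1..n}" "c \<notin> diagram f \<Longrightarrow> T c = 0"
    "(i, j) \<in> diagram f \<Longrightarrow> (Suc i, j) \<in> diagram f \<Longrightarrow> T (i, j) < T (Suc i, j)"
    "(i, j) \<in> diagram f \<Longrightarrow> (i, Suc j) \<in> diagram f \<Longrightarrow> T (i, j) < T (i, Suc j)"
proof -
  note T = assms[unfolded tableau_def]
  show "bij_betw T (diagram f) {1..n}" using T by (elim conjE)
  show "c \<notin> diagram f \<Longrightarrow> T c = 0" using T[THEN conjunct2, THEN conjunct1] by blast
  show "(i, j) \<in> diagram f \<Longrightarrow> (Suc i, j) \<in> diagram f \<Longrightarrow> T (i, j) < T (Suc i, j)"
    using T[THEN conjunct2, THEN conjunct2, THEN conjunct1] by blast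
  show "(i, j) \<in> diagram f \<Longrightarrow> (i, Suc j) \<in> diagram f \<Longrightarrow> T (i, j) < T (i, Suc j)"
    using T[THEN conjunct2, THEN conjunct2, THEN conjunct2] by blast
qed

lemma tableau_cell_iff:
  assumes "tableau f n T"
  shows "c \<in> diagram f \<longleftrightarrow> T c \<noteq> 0" "T c \<le> n"
proof -
  have "T c \<in> {1..n}" if "c \<in> diagram f"
    using assms that bij_betwE unfolding tableau_def by blast
  moreover have "T c = 0" if "c \<notin> diagram f" using tableauD(2)[OF assms that] .
  ultimately show "c \<in> diagram f \<longleftrightarrow> T c \<noteq> 0" "T c \<le> n" by (cases "c \<in> diagram f"; force)+
qed

lemma tableau_add:
  assumes "antimono f" "j = 0 \<or> f j < f (j - 1)" "tableau f n T"
  shows "tableau (grow_row f j) (Suc n) (T((Suc (f j), Suc j) := Suc n))"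
proof -
  define c where "c = (Suc (f j), Suc j)"
  have D: "diagram (grow_row f j) = insert c (diagram f)" "c \<notin> diagram f"
    using diagram_grow_row by (simp_all add: c_def)
  have le: "T x \<le> n" for x using tableau_cell_iff[OF assms(3)] by simp
  have b: "bij_betw T (diagram f) {1..n}" using assms(3) by (simp add: tableau_def)
  have "bij_betw (T(c := Suc n)) (diagram f) {1..n}"
    using b D(2) bij_betw_cong[of "diagram f" "T(c := Suc n)" T] by (metis fun_upd_other)
  then have "bij_betw (T(c := Suc n)) (insert c (diagram f)) (insert (Suc n) {1..n})"
    using bij_betw_combine[of "T(c := Suc n)" "diagram f" "{1..n}" "{c}" "{Suc n}"] by simp
  then have "bij_betw (T(c := Suc n)) (diagram (grow_row f j)) {1..Suc n}"
    unfolding D(1) by (simp add: atLeastAtMostSuc_conv)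
  moreover have "c' \<notin> diagram (grow_row f j) \<longrightarrow> (T(c := Suc n)) c' = 0" for c'
    using tableauD(2)[OF assms(3), of c'] unfolding D(1) by auto
  moreover have "(Suc (Suc (f j)), Suc j) \<notin> diagram f" by (simp add: diagram_def)
  moreover have "(Suc (f j), Suc (Suc j)) \<notin> diagram f"
    using assms(1) by (auto simp: diagram_def antimono_def not_le less_Suc_eq_le)
  ultimately show ?thesis
    using assms(3) le unfolding c_def[symmetric] unfolding tableau_def D(1)
    by (auto simp: c_def less_Suc_eq_le)
qed

text \<open>The cell of the largest entry has no right or upper neighbour in the diagram, so it is a
  corner.\<close>

lemma tableau_remove:
  assumes "antimono f" "tableau f (Suc n) T"
  obtains g j T' where "antimono g" "j = 0 \<or> g j < g (j - 1)" "f = grow_row g j"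
    "tableau g n T'" "T = T'((Suc (g j), Suc j) := Suc n)"
proof -
  have b: "bij_betw T (diagram f) {1..Suc n}" and z: "\<And>c. c \<notin> diagram f \<Longrightarrow> T c = 0"
    and r: "\<And>i j. (i, j) \<in> diagram f \<Longrightarrow> (Suc i, j) \<in> diagram f \<Longrightarrow> T (i, j) < T (Suc i, j)"
    and u: "\<And>i j. (i, j) \<in> diagram f \<Longrightarrow> (i, Suc j) \<in> diagram f \<Longrightarrow> T (i, j) < T (i, Suc j)"
    using assms(2) by (auto simp: tableau_def)
  have "Suc n \<in> T ` diagram f" using b by (auto simp: bij_betw_def)
  then obtain i j' where c: "(i, j') \<in> diagram f" "T (i, j') = Suc n" by force
  then obtain j where j: "j' = Suc j" by (cases j') (auto simp: diagram_def)
  have max: "T x \<le> Suc n" for x using tableau_cell_iff[OF assms(2)] by simp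
  have nr: "(Suc i, Suc j) \<notin> diagram f" using r[of i "Suc j"] c j max[of "(Suc i, Suc j)"] by auto
  have nu: "(i, Suc (Suc j)) \<notin> diagram f" using u[of i "Suc j"] c j max[of "(i, Suc (Suc j))"] by auto
  have i: "i = f j" "f (Suc j) < f j" "1 \<le> i" using nr nu c(1) j by (auto simp: diagram_def)
  define g where "g = f(j := f j - 1)"
  have fg: "f = grow_row g j" "Suc (g j) = i" using i by (auto simp: grow_row_def g_def)
  have ag: "antimono g"
  proof (rule antimonoI)
    fix x y :: nat assume xy: "x \<le> y"
    have le: "f y \<le> f x" using assms(1) xy by (simp add: antimono_def)
    have "f y \<le> f j - 1" if "j < y"
    proof -
      have "f y \<le> f (Suc j)" using assms(1) that by (simp add: antimono_def)
      then show ?thesis using i(2) by linarith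
    qed
    then show "g y \<le> g x" using le xy by (auto simp: g_def)
  qed
  have gj: "j = 0 \<or> g j < g (j - 1)"
  proof (cases "j = 0")
    case False
    have "f j \<le> f (j - 1)" using assms(1) by (simp add: antimono_def)
    moreover have "f j - 1 < f j" using i(1,3) by simp
    moreover have "j - 1 \<noteq> j" using False by simp
    ultimately have "g j < g (j - 1)" unfolding g_def by simp
    then show ?thesis by simp
  qed simp
  define c where "c = (Suc (g j), Suc j)"
  have D: "diagram f = insert c (diagram g)" "c \<notin> diagram g"
    using diagram_grow_row[of g j] fg(1) by (simp_all add: c_def)
  have Tc: "T c = Suc n" using c(2) j fg(2) by (simp add: c_def)
  have "bij_betw T (diagram g \<union> {c}) ({1..n} \<union> {T c})"
    using b unfolding D(1) Tc by (simp add: atLeastAtMostSuc_conv)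
  then have "bij_betw T (diagram g) {1..n}"
    using notIn_Un_bij_betw3[OF D(2), of T "{1..n}"] Tc by simp
  then have "bij_betw (T(c := 0)) (diagram g) {1..n}"
    using D(2) bij_betw_cong[of "diagram g" "T(c := 0)" T] by (metis fun_upd_other)
  then have "tableau g n (T(c := 0))"
    using z r u D unfolding tableau_def by (auto simp del: split_paired_All)
  moreover have "T = (T(c := 0))(c := Suc n)" using Tc by auto
  ultimately show ?thesis using that ag gj fg(1) unfolding c_def by blast
qed

definition content_word :: "nat \<Rightarrow> (nat \<times> nat \<Rightarrow> nat) \<Rightarrow> int list" where
  "content_word n T = map (\<lambda>m. content (THE c. T c = m)) [1..<Suc n]"

lemma length_content_word [simp]: "length (content_word n T) = n"
  by (simp add: content_word_def)

lemma nth_content_word: "m < n \<Longrightarrow> content_word n T ! m = content (THE c. T c = Suc m)"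
  by (simp add: content_word_def del: upt_Suc)

lemma content_word_add:
  assumes "tableau f n T" "c \<notin> diagram f"
  shows "content_word (Suc n) (T(c := Suc n)) = content_word n T @ [content c]"
proof (rule nth_equalityI)
  fix m assume m: "m < length (content_word (Suc n) (T(c := Suc n)))"
  have Tc: "T c = 0" by (rule tableauD(2)[OF assms])
  show "content_word (Suc n) (T(c := Suc n)) ! m = (content_word n T @ [content c]) ! m"
  proof (cases "m = n")
    case True
    have "(THE c'. (T(c := Suc n)) c' = Suc n) = c"
    proof (rule the_equality)
      fix c' assume "(T(c := Suc n)) c' = Suc n"
      then show "c' = c" using tableau_cell_iff(2)[OF assms(1), of c'] by (cases "c' = c") auto
    qed simp
    then show ?thesis using True by (simp add: nth_content_word nth_append)
  next
    case False
    then have "m < n" using m by simp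
    moreover have "((T(c := Suc n)) c' = Suc m) = (T c' = Suc m)" for c' using Tc \<open>m < n\<close> by auto
    ultimately show ?thesis by (simp add: nth_content_word nth_append)
  qed
qed simp

lemma content_word_std:
  assumes "antimono f" "tableau f n T"
  shows "std_word (content_word n T) \<and> shape (content_word n T) = edge_seq f"
  using assms
proof (induction n arbitrary: f T)
  case 0
  have "diagram f = {}" using 0(2) by (auto simp: tableau_def bij_betw_def)
  have "f j = 0" for j
  proof (rule ccontr)
    assume "f j \<noteq> 0"
    then have "(1, Suc j) \<in> diagram f" by (simp add: diagram_def)
    then show False using \<open>diagram f = {}\<close> by simp
  qed
  then have "f = (\<lambda>_. 0)" by auto
  then show ?case by (simp add: content_word_def edge_seq_zero)
next
  case (Suc n)
  obtain g j T' where g: "antimono g" "j = 0 \<or> g j < g (j - 1)" "f = grow_row g j"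
    "tableau g n T'" "T = T'((Suc (g j), Suc j) := Suc n)"
    using tableau_remove[OF Suc.prems] by blast
  define k where "k = int (g j) - int j"
  have cw: "content_word (Suc n) T = content_word n T' @ [k]"
    unfolding g(5) content_word_add[OF g(4) diagram_grow_row(2)] by (simp add: content_def k_def)
  have "addable (edge_seq g) k" using addable_edge_seq[OF g(1)] g(2) k_def by blast
  then show ?case
    using Suc.IH[OF g(1,4)] add_cell_edge_seq[OF g(1) k_def] by (simp add: cw std_word_snoc shape_snoc g(3))
qed

lemma content_word_inj:
  assumes "antimono f" "tableau f n T" "tableau f n T'" "content_word n T = content_word n T'"
  shows "T = T'"
  using assms
proof (induction n arbitrary: f T T')
  case 0
  have "T c = 0" "T' c = 0" for c
    using tableau_cell_iff(2)[OF 0(2), of c] tableau_cell_iff(2)[OF 0(3), of c] by auto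
  then show ?case by auto
next
  case (Suc n)
  obtain g j S where g: "antimono g" "j = 0 \<or> g j < g (j - 1)" "f = grow_row g j"
    "tableau g n S" "T = S((Suc (g j), Suc j) := Suc n)"
    using tableau_remove[OF Suc.prems(1,2)] by blast
  obtain g' j' S' where g': "antimono g'" "j' = 0 \<or> g' j' < g' (j' - 1)" "f = grow_row g' j'"
    "tableau g' n S'" "T' = S'((Suc (g' j'), Suc j') := Suc n)"
    using tableau_remove[OF Suc.prems(1,3)] by blast
  have eq: "content_word n S = content_word n S'" "int (g j) - int j = int (g' j') - int j'"
    using Suc.prems(4) unfolding g(5) g'(5) content_word_add[OF g(4) diagram_grow_row(2)]
      content_word_add[OF g'(4) diagram_grow_row(2)] by (simp_all add: content_def)
  \<comment> \<open>In the common shape the content at the end of a row determines the row, so both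
    largest entries sit in the same cell.\<close>
  have "int (f j) - int j = int (g j) - int j + 1" by (simp add: g(3) grow_row_def)
  moreover have "int (f j') - int j' = int (g' j') - int j' + 1" by (simp add: g'(3) grow_row_def)
  ultimately have jj: "j = j'" using edge_seq_index_inj[OF Suc.prems(1)] eq(2) by metis
  have "g x = g' x" for x
    using fun_cong[OF g(3)[unfolded g'(3)], of x] jj by (auto simp: grow_row_def split: if_splits)
  then have gg: "g = g'" by auto
  then have "S = S'" using Suc.IH[OF g(1,4)] g'(4) eq(1) by simp
  then show ?case using g(5) g'(5) gg jj by simp
qed

lemma content_word_surj:
  assumes "std_word w"
  shows "\<exists>f T. antimono f \<and> tableau f (length w) T \<and> content_word (length w) T = w"
  using assms
proof (induction w rule: rev_induct)
  case Nil
  have "diagram (\<lambda>_. 0) = {}" by (auto simp: diagram_def)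
  then have "tableau (\<lambda>_. 0) 0 (\<lambda>_. 0)" by (simp add: tableau_def bij_betw_def)
  then show ?case by (intro exI[of _ "\<lambda>_. 0"]) (auto simp: content_word_def antimono_def)
next
  case (snoc k w)
  then obtain f T where f: "antimono f" "tableau f (length w) T" "content_word (length w) T = w"
    by (auto simp: std_word_snoc)
  have "shape w = edge_seq f" using content_word_std[OF f(1,2)] f(3) by simp
  then have "addable (edge_seq f) k" using snoc.prems by (simp add: std_word_snoc)
  then obtain j where j: "k = int (f j) - int j" "j = 0 \<or> f j < f (j - 1)"
    using addable_edge_seq[OF f(1)] by blast
  have "content_word (Suc (length w)) (T((Suc (f j), Suc j) := Suc (length w))) = w @ [k]"
    unfolding content_word_add[OF f(2) diagram_grow_row(2)] f(3) by (simp add: content_def j(1))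
  then show ?case using antimono_grow_row[OF f(1) j(2)] tableau_add[OF f(1) j(2) f(2)]
    by (metis length_append_singleton)
qed

section \<open>Exchanging two consecutive entries\<close>

definition cell_of :: "(nat \<times> nat \<Rightarrow> nat) \<Rightarrow> nat \<Rightarrow> nat \<times> nat" where
  "cell_of T m = (THE c. T c = m)"

lemma cell_of:
  assumes "tableau f n T"
  shows "1 \<le> m \<Longrightarrow> m \<le> n \<Longrightarrow> T (cell_of T m) = m"
    and "1 \<le> m \<Longrightarrow> m \<le> n \<Longrightarrow> cell_of T m \<in> diagram f"
    and "c \<in> diagram f \<Longrightarrow> cell_of T (T c) = c"
proof -
  have b: "bij_betw T (diagram f) {1..n}" using tableauD(1)[OF assms] .
  show 3: "cell_of T (T c) = c" if c: "c \<in> diagram f" for c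
    unfolding cell_of_def
  proof (rule the_equality)
    fix c' assume eq: "T c' = T c"
    then have "c' \<in> diagram f" using tableau_cell_iff(1)[OF assms] c by auto
    then show "c' = c" using eq c b by (auto simp: bij_betw_def inj_on_def)
  qed simp
  assume m: "1 \<le> m" "m \<le> n"
  then have "m \<in> T ` diagram f" using b by (simp add: bij_betw_def)
  then obtain c where "c \<in> diagram f" "T c = m" by blast
  then show "T (cell_of T m) = m" "cell_of T m \<in> diagram f" using 3[of c] by auto
qed

lemma nth_content_word_cell_of: "m < n \<Longrightarrow> content_word n T ! m = content (cell_of T (Suc m))"
  by (simp add: nth_content_word cell_of_def)

lemma swap_vals_involution [simp]: "swap_vals a b (swap_vals a b x) = x"
  by (simp add: swap_vals_def)

lemma swap_vals_commute: "swap_vals a b = swap_vals b a"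
  by (auto simp: swap_vals_def)

lemma bij_betw_swap_vals:
  assumes "a \<in> A" "b \<in> A"
  shows "bij_betw (swap_vals a b) A A"
  by (rule bij_betw_byWitness[where f' = "swap_vals a b"]) (use assms in \<open>auto simp: swap_vals_def\<close>)

text \<open>Neighbouring cells have contents differing by one, so \<open>k\<close> and \<open>k + 1\<close> are not neighbours.\<close>
lemma tableau_swap:
  assumes "tableau f n T" "k < n" "1 \<le> k"
    and x: "x = content_word n T ! (k - 1)" and y: "y = content_word n T ! k"
    and far: "x + 2 \<le> y \<or> y + 2 \<le> x"
  shows "tableau f n (swap_vals k (Suc k) \<circ> T)"
    and "content_word n (swap_vals k (Suc k) \<circ> T) = (content_word n T)[k - 1 := y, k := x]"
proof -
  let ?s = "swap_vals k (Suc k)"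
  have xy: "x = content (cell_of T k)" "y = content (cell_of T (Suc k))"
    using assms(2,3) x y by (simp_all add: nth_content_word_cell_of)
  have ord: "?s (T a) < ?s (T b)"
    if "T a < T b" "a \<in> diagram f" "b \<in> diagram f" "\<bar>content a - content b\<bar> = 1" for a b
  proof -
    have "\<not> (T a = k \<and> T b = Suc k)"
    proof
      assume "T a = k \<and> T b = Suc k"
      then have "cell_of T k = a" "cell_of T (Suc k) = b"
        using cell_of(3)[OF assms(1)] that(2,3) by metis+
      then show False using far xy that(4) by auto
    qed
    then show ?thesis using that(1) by (auto simp: swap_vals_def)
  qed
  have "bij_betw ?s {1..n} {1..n}" by (rule bij_betw_swap_vals) (use assms(2,3) in auto)
  then have "bij_betw (?s \<circ> T) (diagram f) {1..n}"
    using bij_betw_trans tableauD(1)[OF assms(1)] by blast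
  moreover have "(?s \<circ> T) c = 0" if "c \<notin> diagram f" for c
    using tableauD(2)[OF assms(1) that] assms(3) by (simp add: swap_vals_def)
  moreover have "(?s \<circ> T) (i, j) < (?s \<circ> T) (Suc i, j)" if "(i, j) \<in> diagram f" "(Suc i, j) \<in> diagram f" for i j
    using ord[OF tableauD(3)[OF assms(1) that] that] by (simp add: content_def)
  moreover have "(?s \<circ> T) (i, j) < (?s \<circ> T) (i, Suc j)" if "(i, j) \<in> diagram f" "(i, Suc j) \<in> diagram f" for i j
    using ord[OF tableauD(4)[OF assms(1) that] that] by (simp add: content_def)
  ultimately show "tableau f n (?s \<circ> T)" unfolding tableau_def by blast
  have "(?s (T c) = m) = (T c = ?s m)" for c m by (metis swap_vals_involution)
  then have c: "cell_of (?s \<circ> T) m = cell_of T (?s m)" for m by (simp add: cell_of_def)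
  show "content_word n (?s \<circ> T) = (content_word n T)[k - 1 := y, k := x]"
  proof (rule nth_equalityI)
    fix m assume "m < length (content_word n (?s \<circ> T))"
    then have m: "m < n" by simp
    consider "m = k" | "m = k - 1" "m \<noteq> k" | "m \<noteq> k" "m \<noteq> k - 1" by blast
    then show "content_word n (?s \<circ> T) ! m = (content_word n T)[k - 1 := y, k := x] ! m"
      by cases (use m assms(2,3) xy in \<open>auto simp: nth_content_word_cell_of c swap_vals_def\<close>)
  qed simp
qed

section \<open>Partition lists and row functions\<close>

definition row :: "nat list \<Rightarrow> nat \<Rightarrow> nat" where
  "row lam j = (if j < length lam then lam ! j else 0)"

lemma cells_eq_diagram: "cells lam = diagram (row lam)"
  by (auto simp: cells_def diagram_def row_def)

lemma SYT_eq_tableau: "T \<in> SYT lam \<longleftrightarrow> tableau (row lam) (sum_list lam) T"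
  unfolding SYT_def tableau_def cells_eq_diagram mem_Collect_eq ..

lemma antimono_row:
  assumes "is_partition lam"
  shows "antimono (row lam)"
proof (rule antimonoI)
  fix x y :: nat assume "x \<le> y"
  then show "row lam y \<le> row lam x"
    using assms sorted_wrt_nth_less[of "(\<ge>)" lam x y] by (cases "x = y") (auto simp: row_def is_partition_def)
qed

lemma row_pos: "is_partition lam \<Longrightarrow> j < length lam \<Longrightarrow> 0 < row lam j"
  by (auto simp: row_def is_partition_def) (metis gr0I nth_mem)

lemma row_inj:
  assumes "is_partition lam" "is_partition mu" "row lam = row mu"
  shows "lam = mu"
proof (rule nth_equalityI)
  have "row lam (length lam) = 0" "row mu (length mu) = 0" by (simp_all add: row_def)
  then have "\<not> length lam < length mu" "\<not> length mu < length lam"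
    using row_pos[OF assms(1), of "length mu"] row_pos[OF assms(2), of "length lam"] assms(3) by auto
  then show len: "length lam = length mu" by simp
  fix j assume "j < length lam"
  then show "lam ! j = mu ! j" using fun_cong[OF assms(3), of j] len by (simp add: row_def)
qed

lemma card_diagram_row: "card (diagram (row lam)) = sum_list lam"
proof -
  let ?S = "Sigma {0..<length lam} (\<lambda>j. {1..lam ! j})"
  let ?h = "\<lambda>(j, i). (i, Suc j)"
  have "diagram (row lam) = ?h ` ?S"
  proof
    show "diagram (row lam) \<subseteq> ?h ` ?S"
    proof
      fix c assume c: "c \<in> diagram (row lam)"
      then obtain i j where ij: "c = (i, Suc j)" by (cases c; cases "snd c") (auto simp: diagram_def)
      then have "(j, i) \<in> ?S" using c by (auto simp: diagram_def row_def split: if_splits)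
      then show "c \<in> ?h ` ?S" using ij by (intro image_eqI[of _ _ "(j, i)"]) auto
    qed
  qed (auto simp: diagram_def row_def)
  moreover have "inj_on ?h ?S" by (auto simp: inj_on_def)
  ultimately have "card (diagram (row lam)) = card ?S" by (simp add: card_image)
  then show ?thesis by (simp add: sum_list_sum_nth)
qed

lemma tableau_card: "tableau f n T \<Longrightarrow> finite (diagram f) \<and> card (diagram f) = n"
  using tableauD(1) bij_betw_finite bij_betw_same_card by (metis card_atLeastAtMost diff_Suc_1 finite_atLeastAtMost)

lemma ex_partition:
  assumes "antimono f" "tableau f n T"
  shows "\<exists>lam. is_partition lam \<and> sum_list lam = n \<and> row lam = f"
proof -
  \<comment> \<open>Without an empty row the first column would be infinite, while the tableau has
    \<open>n\<close> cells.\<close>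
  have "\<exists>j. f j = 0"
  proof (rule ccontr)
    assume "\<nexists>j. f j = 0"
    then have "(\<lambda>j. (1, Suc j)) ` UNIV \<subseteq> diagram f" by (auto simp: diagram_def Suc_le_eq)
    then have "finite ((\<lambda>j. (1 :: nat, Suc j)) ` UNIV)"
      using tableau_card[OF assms(2)] finite_subset by blast
    then show False by (simp add: finite_image_iff inj_on_def)
  qed
  define l where "l = (LEAST j. f j = 0)"
  have l: "f l = 0" using \<open>\<exists>j. f j = 0\<close> unfolding l_def by (rule LeastI_ex)
  have pos: "f j \<noteq> 0" if "j < l" for j using that not_less_Least unfolding l_def by blast
  define lam where "lam = map f [0..<l]"
  have "f j = 0" if "\<not> j < l" for j
    using antimonoD[OF assms(1), of l j] l that by simp
  then have r: "row lam = f" by (auto simp: row_def lam_def)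
  have "is_partition lam"
    unfolding is_partition_def sorted_wrt_iff_nth_less
    using pos antimonoD[OF assms(1)] by (force simp: lam_def)
  moreover have "sum_list lam = n" using card_diagram_row[of lam] r tableau_card[OF assms(2)] by simp
  ultimately show ?thesis using r by blast
qed

section \<open>Reading words, descents and elementary dual equivalences\<close>

lemma pos_reading_word:
  assumes "T \<in> SYT lam" "c \<in> cells lam" "d \<in> cells lam"
  shows "pos (reading_word lam T) (T c) < pos (reading_word lam T) (T d) \<longleftrightarrow>
    (content c, fst c) < (content d, fst d)"
proof -
  let ?key = "\<lambda>c. (content c, fst c)"
  define rc where "rc = reading_cells lam"
  have tab: "tableau (row lam) (sum_list lam) T" using assms(1) by (simp add: SYT_eq_tableau)
  have fin: "finite (cells lam)" using tableau_card[OF tab] by (simp add: cells_eq_diagram)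
  have rc: "set rc = cells lam" "distinct rc" "sorted (map ?key rc)"
    using fin by (simp_all add: rc_def reading_cells_def)
  have inj: "inj ?key" by (auto simp: inj_def content_def)
  have injT: "inj_on T (set rc)" using tableauD(1)[OF tab] rc(1) by (simp add: bij_betw_def cells_eq_diagram)
  have pos: "pos (reading_word lam T) (T (rc ! p)) = p" if p: "p < length rc" for p
    unfolding pos_def reading_word_def rc_def[symmetric]
  proof (rule Least_equality)
    fix q assume q: "q < length (map T rc) \<and> map T rc ! q = T (rc ! p)"
    then have "rc ! q = rc ! p" using p injT by (auto simp: inj_on_def)
    then show "p \<le> q" using q p rc(2) by (simp add: nth_eq_iff_index_eq)
  qed (use p in simp)
  have less: "?key (rc ! p) < ?key (rc ! q)" if "p < q" "q < length rc" for p q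
  proof -
    have "?key (rc ! p) \<le> ?key (rc ! q)" using sorted_nth_mono[OF rc(3), of p q] that by simp
    moreover have "rc ! p \<noteq> rc ! q" using that rc(2) by (simp add: nth_eq_iff_index_eq)
    ultimately show ?thesis using inj unfolding inj_def by (metis order_le_imp_less_or_eq)
  qed
  obtain p q where pq: "p < length rc" "c = rc ! p" "q < length rc" "d = rc ! q"
    using assms(2,3) rc(1) by (metis in_set_conv_nth)
  show ?thesis
    unfolding pq(2,4) pos[OF pq(1)] pos[OF pq(3)]
    using less[of p q] less[of q p] pq by (cases p q rule: linorder_cases) auto
qed

text \<open>Columns only break ties on a diagonal, so for different contents the reading order is
  the order of contents.\<close>

lemma pos_less_iff:
  assumes "T \<in> SYT lam" "a < sum_list lam" "b < sum_list lam"
    and "content_word (sum_list lam) T ! a \<noteq> content_word (sum_list lam) T ! b"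
  shows "pos (reading_word lam T) (Suc a) < pos (reading_word lam T) (Suc b) \<longleftrightarrow>
    content_word (sum_list lam) T ! a < content_word (sum_list lam) T ! b"
proof -
  have tab: "tableau (row lam) (sum_list lam) T" using assms(1) by (simp add: SYT_eq_tableau)
  have a: "cell_of T (Suc a) \<in> cells lam" "T (cell_of T (Suc a)) = Suc a"
    and b: "cell_of T (Suc b) \<in> cells lam" "T (cell_of T (Suc b)) = Suc b"
    using cell_of(1,2)[OF tab, of "Suc a"] cell_of(1,2)[OF tab, of "Suc b"] assms(2,3)
    by (simp_all add: cells_eq_diagram)
  show ?thesis
    using pos_reading_word[OF assms(1) a(1) b(1)] assms(2-4) unfolding a(2) b(2)
    by (auto simp: nth_content_word_cell_of)
qed

lemma std_content_word:
  assumes "is_partition lam" "T \<in> SYT lam"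
  shows "std_word (content_word (sum_list lam) T)" "shape (content_word (sum_list lam) T) = edge_seq (row lam)"
  using content_word_std[OF antimono_row[OF assms(1)]] assms(2) SYT_eq_tableau by blast+

lemma growth_pair_distinct: "growth e (x # y # b) \<Longrightarrow> x \<noteq> y"
  by (auto simp: addable_def add_cell_def)

lemma desc_sig_eq_asc:
  assumes "is_partition lam" "T \<in> SYT lam" "1 \<le> k" "k < sum_list lam"
  shows "desc_sig lam T k \<longleftrightarrow> asc (content_word (sum_list lam) T) k"
proof -
  define w where "w = content_word (sum_list lam) T"
  have len: "length w = sum_list lam" by (simp add: w_def)
  obtain j where j: "k = Suc j" using assms(3) by (cases k) auto
  have "w = take j w @ drop j w" by simp
  moreover have "drop j w = w ! j # w ! k # drop (Suc k) w"
    using assms(4) len j Cons_nth_drop_Suc[of j w] Cons_nth_drop_Suc[of k w] by simp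
  ultimately have "std_word (take j w @ w ! j # w ! k # drop (Suc k) w)"
    using std_content_word(1)[OF assms(1,2)] by (simp add: w_def[symmetric])
  then have "w ! j \<noteq> w ! k" using growth_pair_distinct unfolding std_word_append by blast
  then show ?thesis
    using pos_less_iff[OF assms(2), of j k] assms(4) j by (simp add: desc_sig_def asc_def w_def[symmetric])
qed

text \<open>If \<open>i\<close> is not between \<open>i - 1\<close> and \<open>i + 1\<close> in the
  reading word, it is first or last of the three, and the farther of the two lies beyond the nearer.
  Distances thus reduce to which entry is the median, which contents decide as they are
  distinct.\<close>

lemma tab_d_dual_move:
  assumes "is_partition lam" "T \<in> SYT lam" "1 < i" "i < sum_list lam"
  shows "tab_d lam i T \<in> SYT lam"
    and "content_word (sum_list lam) (tab_d lam i T) = dual_move i (content_word (sum_list lam) T)"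
proof -
  define n where "n = sum_list lam"
  define w where "w = content_word n T"
  define p where "p = pos (reading_word lam T)"
  have tab: "tableau (row lam) n T" using assms(2) by (simp add: SYT_eq_tableau n_def)
  obtain j where j: "i = Suc (Suc j)" using assms(3) by (auto simp: numeral_2_eq_2 dest: less_imp_Suc_add)
  have n: "Suc (Suc j) < n" using assms(4) j by (simp add: n_def)
  define x y z where "x = w ! j" and "y = w ! Suc j" and "z = w ! Suc (Suc j)"
  have "std_word w" using std_content_word(1)[OF assms(1,2)] by (simp add: w_def n_def)
  moreover have "drop j w = x # y # z # drop (Suc i) w"
    using n j Cons_nth_drop_Suc[of j w] Cons_nth_drop_Suc[of "Suc j" w] Cons_nth_drop_Suc[of "Suc (Suc j)" w]
    by (simp add: x_def y_def z_def w_def)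
  ultimately have "growth (shape (take j w)) (x # y # z # drop (Suc i) w)"
    using std_word_append[of "take j w" "drop j w"] unfolding append_take_drop_id by simp
  then have dist: "x \<noteq> y" "y \<noteq> z" "x \<noteq> z" using growth_triple_distinct by blast+
  have pl: "p (Suc a) < p (Suc b) \<longleftrightarrow> w ! a < w ! b" if "a < n" "b < n" "w ! a \<noteq> w ! b" for a b
    using pos_less_iff[OF assms(2)] that unfolding p_def w_def n_def by blast
  have P: "p (Suc j) < p (Suc (Suc j)) \<longleftrightarrow> x < y" "p (Suc (Suc j)) < p (Suc j) \<longleftrightarrow> y < x"
    "p (Suc (Suc j)) < p (Suc (Suc (Suc j))) \<longleftrightarrow> y < z" "p (Suc (Suc (Suc j))) < p (Suc (Suc j)) \<longleftrightarrow> z < y"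
    "p (Suc j) < p (Suc (Suc (Suc j))) \<longleftrightarrow> x < z" "p (Suc (Suc (Suc j))) < p (Suc j) \<longleftrightarrow> z < x"
    using pl[of j "Suc j"] pl[of "Suc j" j] pl[of "Suc j" "Suc (Suc j)"] pl[of "Suc (Suc j)" "Suc j"]
      pl[of j "Suc (Suc j)"] pl[of "Suc (Suc j)" j] n dist by (simp_all add: x_def y_def z_def)
  have dp: "d_perm i (reading_word lam T) =
    (if between x y z then id else if between x z y then swap_vals (Suc j) i else swap_vals i (Suc i))"
  proof -
    have "d_perm i (reading_word lam T) =
     (if (p (Suc j) < p i \<and> p i < p (Suc i)) \<or> (p (Suc i) < p i \<and> p i < p (Suc j)) then id
     else if \<bar>int (p i) - int (p (Suc j))\<bar> > \<bar>int (p i) - int (p (Suc i))\<bar>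
       then swap_vals i (Suc j) else swap_vals i (Suc i))"
      by (simp add: d_perm_def Let_def p_def[symmetric] j)
    moreover have "(p (Suc j) < p i \<and> p i < p (Suc i)) \<or> (p (Suc i) < p i \<and> p i < p (Suc j)) \<longleftrightarrow> between x y z"
      using P unfolding j between_def by simp
    moreover have "\<bar>int (p i) - int (p (Suc j))\<bar> > \<bar>int (p i) - int (p (Suc i))\<bar> \<longleftrightarrow> between x z y"
      if nb: "\<not> between x y z"
    proof -
      consider "x < y" "z < y" | "y < x" "y < z"
        using nb dist unfolding between_def by (metis linorder_neqE)
      then show ?thesis
      proof cases
        case 1
        then show ?thesis using P dist unfolding j between_def by linarith
      next
        case 2
        then show ?thesis using P dist unfolding j between_def by linarith
      qed
    qed
    ultimately show ?thesis using swap_vals_commute[of i "Suc j"] by simp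
  qed
  have dm: "dual_move i w = (if between y x z then w[Suc j := z, i := y]
     else if between x z y then w[j := y, Suc j := x] else w)"
    by (simp add: dual_move_def j x_def y_def z_def)
  have td: "tab_d lam i T = d_perm i (reading_word lam T) \<circ> T" by (simp add: tab_d_def)
  have "tableau (row lam) n (tab_d lam i T) \<and> content_word n (tab_d lam i T) = dual_move i w"
  proof -
    consider "between x y z" | "between x z y" | "between y x z" using dist unfolding between_def by (metis linorder_neqE)
    then show ?thesis
    proof cases
      case 1
      then have "\<not> between x z y" "\<not> between y x z" by (auto simp: between_def)
      then show ?thesis using 1 tab unfolding td dp dm by (simp add: w_def)
    next
      case 2
      then have nb: "\<not> between x y z" "\<not> between y x z" and far: "x + 2 \<le> y \<or> y + 2 \<le> x"
        by (auto simp: between_def)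
      show ?thesis using tableau_swap[OF tab, of "Suc j" x y] 2 nb far n unfolding td dp dm
        by (simp add: j w_def x_def y_def)
    next
      case 3
      then have nb: "\<not> between x y z" "\<not> between x z y" and far: "y + 2 \<le> z \<or> z + 2 \<le> y"
        by (auto simp: between_def)
      show ?thesis using tableau_swap[OF tab, of i y z] 3 nb far n unfolding td dp dm
        by (simp add: j w_def y_def z_def)
    qed
  qed
  then show "tab_d lam i T \<in> SYT lam"
    "content_word (sum_list lam) (tab_d lam i T) = dual_move i (content_word (sum_list lam) T)"
    by (simp_all add: SYT_eq_tableau n_def w_def)
qed

lemma bij_betw_content_word:
  assumes "is_partition lam"
  shows "bij_betw (content_word (sum_list lam)) (SYT lam)
    {w. std_word w \<and> length w = sum_list lam \<and> shape w = edge_seq (row lam)}"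
  unfolding bij_betw_def
proof (intro conjI)
  note am = antimono_row[OF assms]
  show "inj_on (content_word (sum_list lam)) (SYT lam)"
    using content_word_inj[OF am] by (auto simp: inj_on_def SYT_eq_tableau)
  have "w \<in> content_word (sum_list lam) ` SYT lam"
    if w: "std_word w" "length w = sum_list lam" "shape w = edge_seq (row lam)" for w
  proof -
    obtain f T where f: "antimono f" "tableau f (length w) T" "content_word (length w) T = w"
      using content_word_surj[OF w(1)] by blast
    then have "edge_seq f = edge_seq (row lam)" using content_word_std[OF f(1,2)] w(3) by simp
    then have "f = row lam" using edge_seq_inj[OF f(1) am] by blast
    then show ?thesis using f w(2) by (auto simp: SYT_eq_tableau)
  qed
  then show "content_word (sum_list lam) ` SYT lam =
      {w. std_word w \<and> length w = sum_list lam \<and> shape w = edge_seq (row lam)}"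
    using std_content_word[OF assms] by auto
qed

section \<open>Isomorphisms seen through content words\<close>

lemma scg_iso_edge_move:
  assumes "is_partition lam" "sum_list lam = n"
    and iso: "scg_iso n n C s E (SYT lam) (desc_sig lam) (G_edges lam) \<phi>"
    and "x \<in> C" "y \<in> C" "1 < i" "i < n" "{x, y} \<in> E i"
  shows "content_word n (\<phi> y) = dual_move i (content_word n (\<phi> x))"
proof -
  have S: "\<phi> x \<in> SYT lam" "\<phi> y \<in> SYT lam" using iso assms(4,5) by (auto simp: scg_iso_def bij_betw_def)
  have "{\<phi> x, \<phi> y} \<in> G_edges lam i" using iso assms(4-8) by (auto simp: scg_iso_def)
  then obtain T where "T \<in> SYT lam" "{\<phi> x, \<phi> y} = {T, tab_d lam i T}"
    using assms(2,6,7) by (auto simp: G_edges_def)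
  then have "\<phi> y = tab_d lam i (\<phi> x) \<or> \<phi> x = tab_d lam i (\<phi> y)"
    by (auto simp: doubleton_eq_iff)
  then show ?thesis
  proof
    assume "\<phi> x = tab_d lam i (\<phi> y)"
    then have "content_word n (\<phi> x) = dual_move i (content_word n (\<phi> y))"
      using tab_d_dual_move(2)[OF assms(1) S(2) assms(6)] assms(2,7) by simp
    then show ?thesis
      using std_word_dual_move(3)[OF std_content_word(1)[OF assms(1) S(2)] assms(6)] assms(2,7) by simp
  qed (use tab_d_dual_move(2)[OF assms(1) S(1) assms(6)] assms(2,7) in simp)
qed

lemma scg_iso_asc:
  assumes "is_partition lam" "sum_list lam = n"
    and iso: "scg_iso n n C s E (SYT lam) (desc_sig lam) (G_edges lam) \<phi>"
    and "x \<in> C" "1 \<le> k" "k < n"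
  shows "asc (content_word n (\<phi> x)) k = s x k"
proof -
  have "\<phi> x \<in> SYT lam" "desc_sig lam (\<phi> x) k = s x k"
    using iso assms(4-6) by (auto simp: scg_iso_def bij_betw_def)
  then show ?thesis using desc_sig_eq_asc[OF assms(1)] assms(2,5,6) by metis
qed

text \<open>The alternative is phrased by signs alone, so it serves any labelling of the component:
  equal signs mean that the move is trivial.\<close>

lemma component_step:
  assumes "deg n n V s E" "x \<in> component {2..<n} V E v" "1 < i" "i < n"
  obtains y where "y \<in> component {2..<n} V E v" "{x, y} \<in> restrict_edges E (component {2..<n} V E v) i"
  | "s x (i - 1) = s x i"
proof (cases "s x (i - 1) = s x i")
  case False
  have x: "x \<in> V" "conn {2..<n} E v x" using assms(2) by (auto simp: component_def)
  obtain y where y: "{x, y} \<in> E i" using deg_edge_iff[OF assms(1) x(1) assms(3,4)] False by blast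
  have "conn {2..<n} E x y" using y assms(3,4) by (auto intro: conn_edge)
  then have "conn {2..<n} E v y" using x(2) conn_trans by metis
  then have "y \<in> component {2..<n} V E v"
    using deg_edge(2)[OF assms(1) y assms(3,4)] by (simp add: component_def)
  then show ?thesis using that(1) y assms(2) by (simp add: restrict_edges_def)
qed (use that in blast)

text \<open>Signs and edges of \<open>C\<close> are common to both isomorphisms, so the two words at
  \<open>v\<close> show the same ascents along all moves. Rigidity makes the words equal, hence the
  shapes.\<close>

lemma scg_iso_shape_unique:
  assumes "deg n n V s E" "v \<in> V"
    and C: "C = component {2..<n} V E v"
    and lam: "is_partition lam" "sum_list lam = n"
    and mu: "is_partition mu" "sum_list mu = n"
    and iso1: "scg_iso n n C s (restrict_edges E C) (SYT lam) (desc_sig lam) (G_edges lam) \<phi>"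
    and iso2: "scg_iso n n C s (restrict_edges E C) (SYT mu) (desc_sig mu) (G_edges mu) \<psi>"
  shows "lam = mu"
proof -
  have vC: "v \<in> C" using assms(2) by (simp add: C component_def)
  have S: "\<phi> x \<in> SYT lam" "\<psi> x \<in> SYT mu" if "x \<in> C" for x
    using iso1 iso2 that by (auto simp: scg_iso_def bij_betw_def)
  note w1 = std_content_word[OF lam(1) S(1), unfolded lam(2)]
    and w2 = std_content_word[OF mu(1) S(2), unfolded mu(2)]
  note a1 = scg_iso_asc[OF lam iso1] and a2 = scg_iso_asc[OF mu iso2]
  have step: "\<exists>y\<in>C. content_word n (\<phi> y) = dual_move i (content_word n (\<phi> x)) \<and>
      content_word n (\<psi> y) = dual_move i (content_word n (\<psi> x))"
    if x: "x \<in> C" and i: "1 < i" "i < n" for x i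
  proof (rule component_step[OF assms(1) x[unfolded C] i])
    fix y assume "y \<in> component {2..<n} V E v"
      "{x, y} \<in> restrict_edges E (component {2..<n} V E v) i"
    then have y: "y \<in> C" "{x, y} \<in> restrict_edges E C i" by (simp_all add: C)
    then show ?thesis
      using scg_iso_edge_move[OF lam iso1 x y(1) i y(2)] scg_iso_edge_move[OF mu iso2 x y(1) i y(2)] by blast
  next
    assume eq: "s x (i - 1) = s x i"
    have k: "1 \<le> i - 1" "i - 1 < n" "1 \<le> i" using i by auto
    have "dual_move i (content_word n (\<phi> x)) = content_word n (\<phi> x)"
      using std_word_dual_move(4)[OF w1(1)[OF x] i(1)] i(2) eq a1[OF x k(1,2)] a1[OF x k(3) i(2)] by simp
    moreover have "dual_move i (content_word n (\<psi> x)) = content_word n (\<psi> x)"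
      using std_word_dual_move(4)[OF w2(1)[OF x] i(1)] i(2) eq a2[OF x k(1,2)] a2[OF x k(3) i(2)] by simp
    ultimately show ?thesis using x by auto
  qed
  have steps: "\<exists>y\<in>C. content_word n (\<phi> y) = dual_moves ms (content_word n (\<phi> x)) \<and>
      content_word n (\<psi> y) = dual_moves ms (content_word n (\<psi> x))"
    if "x \<in> C" "moves n ms" for x ms
    using that
  proof (induction ms arbitrary: x)
    case (Cons i ms)
    have i: "1 < i" "i < n" "moves n ms" using Cons.prems(2) by (auto simp: moves_def)
    obtain y where y: "y \<in> C" "content_word n (\<phi> y) = dual_move i (content_word n (\<phi> x))"
      "content_word n (\<psi> y) = dual_move i (content_word n (\<psi> x))"
      using step[OF Cons.prems(1) i(1,2)] by blast
    show ?case using Cons.IH[OF y(1) i(3)] y(2,3) by simp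
  qed auto
  have "content_word n (\<phi> v) = content_word n (\<psi> v)"
  proof (rule std_word_eqI[OF w1(1)[OF vC] w2(1)[OF vC]])
    fix ms k assume ms: "moves n ms" and k: "1 \<le> k" "k < n"
    obtain y where "y \<in> C" "content_word n (\<phi> y) = dual_moves ms (content_word n (\<phi> v))"
      "content_word n (\<psi> y) = dual_moves ms (content_word n (\<psi> v))"
      using steps[OF vC ms] by blast
    then show "asc (dual_moves ms (content_word n (\<phi> v))) k = asc (dual_moves ms (content_word n (\<psi> v))) k"
      using a1[of y k] a2[of y k] k by metis
  qed simp_all
  then have "edge_seq (row lam) = edge_seq (row mu)" using w1(2)[OF vC] w2(2)[OF vC] by simp
  then show ?thesis
    using edge_seq_inj[OF antimono_row[OF lam(1)] antimono_row[OF mu(1)]] row_inj[OF lam(1) mu(1)] by blast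
qed

lemma deg_component_iso:
  assumes "deg n n V s E" "v \<in> V"
    and C: "C = component {2..<n} V E v"
  shows "\<exists>lam \<phi>. is_partition lam \<and> sum_list lam = n \<and>
    scg_iso n n C s (restrict_edges E C) (SYT lam) (desc_sig lam) (G_edges lam) \<phi>"
proof -
  obtain \<Phi> where \<Phi>: "labelled n V s E \<Phi>" using deg_labelled[OF assms(1)] by blast
  note lab = labelledD[OF \<Phi>]
  obtain f T where f: "antimono f" "tableau f n T" "content_word n T = \<Phi> v"
    using content_word_surj[OF lab(1)[OF assms(2)]] lab(2)[OF assms(2)] by auto
  obtain lam where lam: "is_partition lam" "sum_list lam = n" "row lam = f"
    using ex_partition[OF f(1,2)] by blast
  have sh: "shape (\<Phi> v) = edge_seq (row lam)" using content_word_std[OF f(1,2)] f(3) lam(3) by simp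
  define W where "W = {w. std_word w \<and> length w = n \<and> shape w = edge_seq (row lam)}"
  have CV: "x \<in> V" "conn {2..<n} E v x" if "x \<in> C" for x using that by (simp_all add: C component_def)
  have bW: "bij_betw (content_word n) (SYT lam) W"
    using bij_betw_content_word[OF lam(1)] lam(2) by (simp add: W_def)
  have inj: "x = y" if "x \<in> C" "y \<in> C" "\<Phi> x = \<Phi> y" for x y
    using lab(5)[OF CV(1)[OF that(1)] CV(1)[OF that(2)] _ that(3)]
      conn_trans conn_sym CV(2)[OF that(1)] CV(2)[OF that(2)] by metis
  have bC: "bij_betw \<Phi> C W"
    unfolding bij_betw_def
  proof (intro conjI subset_antisym subsetI)
    show "inj_on \<Phi> C" using inj by (auto simp: inj_on_def)
    show "w \<in> W" if "w \<in> \<Phi> ` C" for w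
      using that lab(1,2) CV labelled_conn_shape[OF assms(1) \<Phi> assms(2)] sh by (auto simp: W_def)
    show "w \<in> \<Phi> ` C" if w: "w \<in> W" for w
    proof -
      obtain y where "y \<in> V" "conn {2..<n} E v y" "\<Phi> y = w"
        by (rule labelled_surj[OF assms(1) \<Phi> assms(2), of w]) (use w sh in \<open>auto simp: W_def\<close>)
      then show ?thesis by (auto simp: C component_def)
    qed
  qed
  \<comment> \<open>Both the component and \<open>SYT lam\<close> are in bijection with the standard
    words of one shape; matching equal words gives the isomorphism.\<close>
  define \<phi> where "\<phi> = inv_into (SYT lam) (content_word n) \<circ> \<Phi>"
  have b: "bij_betw \<phi> C (SYT lam)"
    unfolding \<phi>_def by (rule bij_betw_trans[OF bC bij_betw_inv_into[OF bW]])
  have S: "\<phi> x \<in> SYT lam" if "x \<in> C" for x using b that by (auto simp: bij_betw_def)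
  have cw: "content_word n (\<phi> x) = \<Phi> x" if "x \<in> C" for x
  proof -
    have "\<Phi> x \<in> W" using bC that by (auto simp: bij_betw_def)
    then show ?thesis using bij_betw_inv_into_right[OF bW] by (simp add: \<phi>_def)
  qed
  have cw_inj: "T = T'" if "T \<in> SYT lam" "T' \<in> SYT lam" "content_word n T = content_word n T'" for T T'
    using bW that by (auto simp: bij_betw_def inj_on_def)
  have "scg_iso n n C s (restrict_edges E C) (SYT lam) (desc_sig lam) (G_edges lam) \<phi>"
    unfolding scg_iso_def
  proof (intro conjI ballI allI impI b; (elim conjE)?)
    fix x k assume x: "x \<in> C" and k: "1 \<le> k" "k < n"
    show "desc_sig lam (\<phi> x) k = s x k"
      using desc_sig_eq_asc[OF lam(1) S[OF x] k(1)] lab(3)[OF CV(1)[OF x] k] k(2) cw[OF x] lam(2) by simp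
  next
    fix i x y assume i: "1 < i" "i < n" and xy: "x \<in> C" "y \<in> C"
    have td: "tab_d lam i (\<phi> z) \<in> SYT lam" "content_word n (tab_d lam i (\<phi> z)) = dual_move i (\<Phi> z)"
      if "z \<in> C" for z
      using tab_d_dual_move[OF lam(1) S[OF that] i(1)] i(2) lam(2) cw[OF that] by simp_all
    \<comment> \<open>The graph must supply an edge wherever tableaux have one: axiom 1 yields some
      \<open>i\<close>-edge at \<open>x\<close>, and injectivity identifies its other end with
      \<open>y\<close>.\<close>
    have edge: "{x, y} \<in> E i" if xy: "x \<in> C" "y \<in> C" and e: "\<phi> y = tab_d lam i (\<phi> x)" "\<phi> y \<noteq> \<phi> x" for x y
    proof -
      have y: "\<Phi> y = dual_move i (\<Phi> x)" using td(2)[OF xy(1)] e(1) cw[OF xy(2)] by simp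
      have ne: "\<Phi> y \<noteq> \<Phi> x" using e(2) inj[OF xy(2,1)] by blast
      have mi: "moves n [i]" using i by (simp add: moves_def)
      have k: "1 \<le> i - 1" "i - 1 < n" "1 \<le> i" using i by auto
      note xV = CV(1)[OF xy(1)]
      have "asc (\<Phi> x) (i - 1) \<noteq> asc (\<Phi> x) i"
        using std_word_dual_move(4)[OF lab(1)[OF xV] i(1)] lab(2)[OF xV] i(2) y ne by simp
      then have "s x (i - 1) \<noteq> s x i" using lab(3)[OF xV k(1,2)] lab(3)[OF xV k(3) i(2)] by simp
      then obtain u where u: "u \<in> C" "{x, u} \<in> E i"
        using component_step[OF assms(1) xy(1)[unfolded C] i] unfolding C[symmetric] restrict_edges_def
        by blast
      have "\<Phi> u = \<Phi> y" using lab(4)[OF i u(2)] y by simp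
      then show ?thesis using inj[OF u(1) xy(2)] u(2) by simp
    qed
    show "{x, y} \<in> restrict_edges E C i \<longleftrightarrow> {\<phi> x, \<phi> y} \<in> G_edges lam i"
    proof
      assume "{x, y} \<in> restrict_edges E C i"
      then have e: "{x, y} \<in> E i" by (simp add: restrict_edges_def)
      have "\<Phi> y = dual_move i (\<Phi> x)" by (rule lab(4)[OF i e])
      then have y: "\<phi> y = tab_d lam i (\<phi> x)"
        using cw_inj[OF S[OF xy(2)] td(1)[OF xy(1)]] cw[OF xy(2)] td(2)[OF xy(1)] by simp
      have "\<phi> y \<noteq> \<phi> x" using deg_edge(3)[OF assms(1) e i] cw[OF xy(1)] cw[OF xy(2)] inj[OF xy] by metis
      then show "{\<phi> x, \<phi> y} \<in> G_edges lam i"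
        using i lam(2) S[OF xy(1)] y by (auto simp: G_edges_def)
    next
      assume "{\<phi> x, \<phi> y} \<in> G_edges lam i"
      then obtain T where T: "{\<phi> x, \<phi> y} = {T, tab_d lam i T}" "tab_d lam i T \<noteq> T"
        using i lam(2) by (auto simp: G_edges_def)
      then consider "\<phi> y = tab_d lam i (\<phi> x)" "\<phi> y \<noteq> \<phi> x" | "\<phi> x = tab_d lam i (\<phi> y)" "\<phi> x \<noteq> \<phi> y"
        unfolding doubleton_eq_iff by metis
      then have "{x, y} \<in> E i"
        by cases (use edge[OF xy] edge[OF xy(2,1)] in \<open>auto simp: insert_commute\<close>)
      then show "{x, y} \<in> restrict_edges E C i" using xy by (simp add: restrict_edges_def)
    qed
  qed
  then show ?thesis using lam by blast
qed

theorem theorem3p5: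
  fixes n :: nat and V :: "'a set" and s :: "'a \<Rightarrow> nat \<Rightarrow> bool" and E :: "nat \<Rightarrow> 'a set set"
    and v :: 'a
  assumes "deg n n V s E"
    and "v \<in> V"
  shows "\<exists>!lam. is_partition lam \<and> sum_list lam = n \<and>
    (\<exists>\<phi>. scg_iso n n (component {2..<n} V E v) s (restrict_edges E (component {2..<n} V E v))
                   (SYT lam) (desc_sig lam) (G_edges lam) \<phi>)"
proof -
  have "lam = mu"
    if "is_partition lam \<and> sum_list lam = n \<and>
      (\<exists>\<phi>. scg_iso n n (component {2..<n} V E v) s (restrict_edges E (component {2..<n} V E v))
        (SYT lam) (desc_sig lam) (G_edges lam) \<phi>)"
      "is_partition mu \<and> sum_list mu = n \<and>
      (\<exists>\<phi>. scg_iso n n (component {2..<n} V E v) s (restrict_edges E (component {2..<n} V E v))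
        (SYT mu) (desc_sig mu) (G_edges mu) \<phi>)" for lam mu
    using that scg_iso_shape_unique[OF assms refl] by blast
  then show ?thesis using deg_component_iso[OF assms refl] by blast
qed

end
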